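(* Consider a mapping $F:\mathbb{R}^n\times\mathbb{R}^m\rightrightarrows\mathbb{R}^m$ and a continuous mapping $\sigma:\Omega\to\mathbb{R}^m$, $\Omega\subset\mathbb{R}^n$ open, satisfying $0\in F(x,\sigma(x))$, $x\in\Omega$. Further assume that for every $x\in\Omega$ the mapping $F$ is SCD semismooth$^*$ at $(x,\sigma(x),0)$ and $\mathrm{scd\,reg}\,F(x,\sigma(x),0)<\infty$. Then $\sigma$ is semismooth on $\Omega$ with respect to the mapping $\Psi:\mathbb{R}^n\rightrightarrows\mathbb{R}^{m\times n}$ given by $$\Psi(x):=\{-X_{L^*}^T : L^*\in\mathcal{S}^*F(x,\sigma(x),0)\},\quad x\in\mathrm{dom}\,\Psi:=\Omega.$$ In particular, for every function $\varphi:D\to\mathbb{R}$ defined on an open set $D\subset\mathbb{R}^n\times\mathbb{R}^m$ containing $\mathrm{gph}\,\sigma$, which is semismooth on $\mathrm{gph}\,\sigma$ with respect to some mapping $\Phi:\mathbb{R}^n\times\mathbb{R}^m\rightrightarrows\mathbb{R}^{1\times(n+m)}$, the function $\theta:\Omega\to\mathbb{R}$, $\theta(x):=\varphi(x,\sigma(x))$, is semismooth on $\Omega$ with respect to the mapping $\Theta:\mathbb{R}^n\rightrightarrows\mathbb{R}^{1\times n}$ given by $$\Theta(x):=\{g_x^T-g_y^TX_{L^*}^T : (g_x^T,g_y^T)\in\Phi(x,\sigma(x)),\ L^*\in\mathcal{S}^*F(x,\sigma(x),0)\},\quad x\in\mathrm{dom}\,\Theta:=\Omega.$$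
   Context: For a multifunction $G:\mathbb{R}^p\rightrightarrows\mathbb{R}^q$, $\mathrm{gph}\,G=\{(x,y) : y\in G(x)\}$. $\mathcal{Z}_{p,q}$ is the metric space of all $p$-dimensional subspaces of $\mathbb{R}^{p+q}=\mathbb{R}^p\times\mathbb{R}^q$ with metric $d(L_1,L_2)=\|P_1-P_2\|$, $P_i$ the orthogonal projection matrix onto $L_i$. Tangent cone: $T_C(z)=\{w : \exists t_k\downarrow0,\ w_k\to w,\ z+t_kw_k\in C\}$. $\mathcal{O}_G$ is the set of $(x,y)\in\mathrm{gph}\,G$ with $T_{\mathrm{gph}\,G}(x,y)\in\mathcal{Z}_{p,q}$, and $\mathcal{S}G(x,y)=\{L\in\mathcal{Z}_{p,q} : \exists(x_k,y_k)\in\mathcal{O}_G,\ (x_k,y_k)\to(x,y),\ d(L,T_{\mathrm{gph}\,G}(x_k,y_k))\to0\}$. For $L\in\mathcal{Z}_{p,q}$, $L^*=\{(-v^*,u^* )\in\mathbb{R}^q\times\mathbb{R}^p : (u^*,v^* )\in L^\perp\}\in\mathcal{Z}_{q,p}$; $\mathcal{S}^*G(x,y)=\{L^* : L\in\mathcal{S}G(x,y)\}$; $(\bigcup\mathcal{S}^*G)(x,y)=\bigcup_{L^*\in\mathcal{S}^*G(x,y)}L^*$. $G$ is SCD semismooth$^*$ (SCD-ss$^*$) at $(\bar x,\bar y)\in\mathrm{gph}\,G$ if $\mathcal{S}^*G(x,y)\neq\emptyset$ for all $(x,y)\in\mathrm{gph}\,G$ sufficiently close to $(\bar x,\bar y)$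 and for every $\epsilon>0$ there is $\delta>0$ with $|\langle x^*,x-\bar x\rangle-\langle y^*,y-\bar y\rangle|\le\epsilon\|(x,y)-(\bar x,\bar y)\|\,\|(y^*,x^* )\|$ for all $(x,y)\in\mathrm{gph}\,G$ with $\|(x,y)-(\bar x,\bar y)\|\le\delta$ and all $(y^*,x^* )\in(\bigcup\mathcal{S}^*G)(x,y)$. These are applied to $F:\mathbb{R}^n\times\mathbb{R}^m\rightrightarrows\mathbb{R}^m$ viewed as a multifunction from $\mathbb{R}^{n+m}$ to $\mathbb{R}^m$, so $\mathcal{S}^*F(x,y,z)\subset\mathcal{Z}_{m,n+m}$, and elements of $L^*\in\mathcal{S}^*F(x,y,z)$ are written $(z^*,x^*,y^* )\in\mathbb{R}^m\times\mathbb{R}^n\times\mathbb{R}^m$. Define $\mathrm{scd\,reg}\,F(x,y,z):=\sup\{\|(z^*,x^* )\| : (z^*,x^*,y^* )\in(\bigcup\mathcal{S}^*F)(x,y,z),\ \|y^*\|\le1\}$. If $L^*\in\mathcal{Z}_{m,n+m}$ satisfies $(z^*,x^*,0)\in L^*\Rightarrow z^*=0,x^*=0$ (which is the case for all $L^*\in\mathcal{S}^*F(x,y,z)$ when $\mathrm{scd\,reg}\,F(x,y,z)<\infty$), there are unique matrices $Z_{L^*}\in\mathbb{R}^{m\times m}$, $X_{L^*}\in\mathbb{R}^{n\times m}$ with $L^*=\{(Z_{L^*}p,X_{L^*}p,p) : p\in\mathbb{R}^m\}$. A mapping $f:\Omega'\to\mathbb{R}^q$ ($\Omega'\subset\mathbb{R}^p$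 open) is semismooth with respect to a multifunction $\Psi:\mathbb{R}^p\rightrightarrows\mathbb{R}^{q\times p}$ at $\bar u\in\Omega'$ if $\mathrm{dom}\,\Psi=\{u : \Psi(u)\neq\emptyset\}$ is a neighborhood of $\bar u$, $\Psi$ is locally bounded at $\bar u$ (its values are uniformly bounded on a neighborhood of $\bar u$), and $\lim_{u\to\bar u,\,u\in\Omega',\,u\ne\bar u}\sup\{\|f(u)-f(\bar u)-A(u-\bar u)\| : A\in\Psi(u)\}/\|u-\bar u\|=0$. It is semismooth on a subset of $\Omega'$ with respect to $\Psi$ if this holds at each point of the subset. Here $g_x\in\mathbb{R}^n$, $g_y\in\mathbb{R}^m$ are column vectors. *)

theory Defs
  imports "HOL-Analysis.Analysis"
begin

text \<open>Throughout, a multifunction is a set-valued function, and \<open>\<real>\<^sup>p\<close>, \<open>\<real>\<^sup>q\<close> are arbitrary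
  Euclidean spaces (\<open>p = DIM('a)\<close>, \<open>q = DIM('b)\<close>). In this way \<open>\<real>\<^sup>n \<times> \<real>\<^sup>m\<close> is itself an
  instance of \<open>\<real>\<^sup>p\<close>; the norm of a product type is the Euclidean one.\<close>

definition gph :: "('a \<Rightarrow> 'b set) \<Rightarrow> ('a \<times> 'b) set" where
  "gph G = {(x, y). y \<in> G x}"

definition grassmann :: "('a::euclidean_space \<times> 'b::euclidean_space) set set" where
  "grassmann = {L. subspace L \<and> dim L = DIM('a)}"

definition orth_proj :: "'c::euclidean_space set \<Rightarrow> 'c \<Rightarrow> 'c" where
  "orth_proj L z = (THE p. p \<in> L \<and> z - p \<in> orthogonal_comp L)"

definition subspace_dist :: "'c::euclidean_space set \<Rightarrow> 'c set \<Rightarrow> real" where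
  "subspace_dist L1 L2 = onorm (\<lambda>z. orth_proj L1 z - orth_proj L2 z)"

definition tangent_cone :: "'c::euclidean_space set \<Rightarrow> 'c \<Rightarrow> 'c set" where
  "tangent_cone C z =
     {w. \<exists>(t :: nat \<Rightarrow> real) ws. (\<forall>k. t k > 0) \<and> t \<longlonglongrightarrow> 0 \<and> ws \<longlonglongrightarrow> w \<and>
           (\<forall>k. z + t k *\<^sub>R ws k \<in> C)}"

definition scd_points ::
    "('a::euclidean_space \<Rightarrow> 'b::euclidean_space set) \<Rightarrow> ('a \<times> 'b) set" where
  "scd_points G = {w \<in> gph G. tangent_cone (gph G) w \<in> grassmann}"

definition scd ::
    "('a::euclidean_space \<Rightarrow> 'b::euclidean_space set) \<Rightarrow> 'a \<times> 'b \<Rightarrow> ('a \<times> 'b) set set" where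
  "scd G w =
     {L \<in> grassmann. \<exists>ws. (\<forall>k. ws k \<in> scd_points G) \<and> ws \<longlonglongrightarrow> w \<and>
        (\<lambda>k. subspace_dist L (tangent_cone (gph G) (ws k))) \<longlonglongrightarrow> 0}"

definition adjoint_subspace ::
    "('a::euclidean_space \<times> 'b::euclidean_space) set \<Rightarrow> ('b \<times> 'a) set" where
  "adjoint_subspace L = {(- v, u) |u v. (u, v) \<in> orthogonal_comp L}"

definition scd_adj ::
    "('a::euclidean_space \<Rightarrow> 'b::euclidean_space set) \<Rightarrow> 'a \<times> 'b \<Rightarrow> ('b \<times> 'a) set set" where
  "scd_adj G w = adjoint_subspace ` scd G w"

definition scd_semismooth_star ::
    "('a::euclidean_space \<Rightarrow> 'b::euclidean_space set) \<Rightarrow> 'a \<times> 'b \<Rightarrow> bool" where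
  "scd_semismooth_star G wbar \<longleftrightarrow>
     wbar \<in> gph G \<and>
     (\<exists>r>0. \<forall>w \<in> gph G. norm (w - wbar) < r \<longrightarrow> scd_adj G w \<noteq> {}) \<and>
     (\<forall>\<epsilon>>0. \<exists>\<delta>>0. \<forall>w \<in> gph G. norm (w - wbar) \<le> \<delta> \<longrightarrow>
        (\<forall>(ys, xs) \<in> \<Union>(scd_adj G w).
           \<bar>xs \<bullet> (fst w - fst wbar) - ys \<bullet> (snd w - snd wbar)\<bar>
             \<le> \<epsilon> * norm (w - wbar) * norm (ys, xs)))"

definition scd_reg ::
    "('a::euclidean_space \<times> 'b::euclidean_space \<Rightarrow> 'c::euclidean_space set) \<Rightarrow>
     ('a \<times> 'b) \<times> 'c \<Rightarrow> ereal" where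
  "scd_reg F w =
     Sup {ereal (norm (z, x)) |z x y. (z, (x, y)) \<in> \<Union>(scd_adj F w) \<and> norm y \<le> 1}"

text \<open>The matrix \<open>X\<close> of a subspace \<open>{(Z p, X p, p) | p}\<close>; it is only meaningful for subspaces
  which have such a representation.\<close>

definition X_mat :: "((real^'m) \<times> (real^'n) \<times> (real^'m)) set \<Rightarrow> real^'m^'n" where
  "X_mat L = (THE X. \<exists>Z :: real^'m^'m. L = {(Z *v p, X *v p, p) |p. True})"

lemma X_mat_eqI:
  fixes Z :: "real^'m^'m" and X :: "real^'m^'n"
  assumes "L = {(Z *v p, X *v p, p) |p. True}"
  shows "X_mat L = X"
  unfolding X_mat_def
proof (rule the_equality)
  show "\<exists>Z :: real^'m^'m. L = {(Z *v p, X *v p, p) |p. True}"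
    using assms by blast
next
  fix Y :: "real^'m^'n"
  assume "\<exists>Z :: real^'m^'m. L = {(Z *v p, Y *v p, p) |p. True}"
  then obtain W :: "real^'m^'m" where "L = {(W *v p, Y *v p, p) |p. True}" by blast
  then have "Y *v p = X *v p" for p
    using assms by blast
  then show "Y = X" by (simp add: matrix_eq)
qed

text \<open>Matrices in \<open>\<real>\<^sup>q\<^sup>\<times>\<^sup>p\<close> are the elements of \<^typ>\<open>'a \<Rightarrow>\<^sub>L 'b\<close>, so that \<open>p\<close> may be the dimension
  of a product space. The function \<open>f\<close> is only relevant on its open domain \<open>U\<close>. The supremum is one
  of reals; for \<open>v\<close> near \<open>u\<close> the set is nonempty and bounded by the two preceding conditions.\<close>

definition semismooth_at ::
    "('a::euclidean_space \<Rightarrow> 'b::euclidean_space) \<Rightarrow> 'a set \<Rightarrow> ('a \<Rightarrow> ('a \<Rightarrow>\<^sub>L 'b) set) \<Rightarrow>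
     'a \<Rightarrow> bool" where
  "semismooth_at f U \<Psi> u \<longleftrightarrow>
     u \<in> interior {v. \<Psi> v \<noteq> {}} \<and>
     (\<exists>r>0. \<exists>B. \<forall>v \<in> ball u r. \<forall>A \<in> \<Psi> v. norm A \<le> B) \<and>
     ((\<lambda>v. (SUP A \<in> \<Psi> v. norm (f v - f u - blinfun_apply A (v - u))) / norm (v - u))
        \<longlongrightarrow> 0) (at u within U)"

definition semismooth_on ::
    "'a set \<Rightarrow> ('a::euclidean_space \<Rightarrow> 'b::euclidean_space) \<Rightarrow> 'a set \<Rightarrow>
     ('a \<Rightarrow> ('a \<Rightarrow>\<^sub>L 'b) set) \<Rightarrow> bool" where
  "semismooth_on S f U \<Psi> \<longleftrightarrow> S \<subseteq> U \<and> (\<forall>u \<in> S. semismooth_at f U \<Psi> u)"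

definition matrix_op :: "real^'p^'q \<Rightarrow> (real^'p) \<Rightarrow>\<^sub>L (real^'q)" where
  "matrix_op A = Blinfun (\<lambda>v. A *v v)"

text \<open>A row vector \<open>g\<^sup>T\<close> is represented by \<open>g\<close>, and it acts by \<open>v \<mapsto> g\<^sup>T v = g \<bullet> v\<close>. In particular
  \<open>(g\<^sub>x\<^sup>T, g\<^sub>y\<^sup>T)\<close> is a pair of vectors.\<close>

abbreviation row_op :: "'a::euclidean_space \<Rightarrow> 'a \<Rightarrow>\<^sub>L real" where
  "row_op \<equiv> blinfun_inner_right"

definition Psi_map ::
    "((real^'n) \<times> (real^'m) \<Rightarrow> (real^'m) set) \<Rightarrow> (real^'n) set \<Rightarrow> (real^'n \<Rightarrow> real^'m) \<Rightarrow>
     real^'n \<Rightarrow> (real^'n^'m) set" where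
  "Psi_map F \<Omega> \<sigma> x =
     (if x \<in> \<Omega> then {- transpose (X_mat L) |L. L \<in> scd_adj F ((x, \<sigma> x), 0)} else {})"

definition Theta_map ::
    "((real^'n) \<times> (real^'m) \<Rightarrow> (real^'m) set) \<Rightarrow> (real^'n) set \<Rightarrow> (real^'n \<Rightarrow> real^'m) \<Rightarrow>
     ((real^'n) \<times> (real^'m) \<Rightarrow> ((real^'n) \<times> (real^'m)) set) \<Rightarrow> real^'n \<Rightarrow> (real^'n) set" where
  "Theta_map F \<Omega> \<sigma> \<Phi> x =
     (if x \<in> \<Omega> then {gx - gy v* transpose (X_mat L) |gx gy L.
                      (gx, gy) \<in> \<Phi> (x, \<sigma> x) \<and> L \<in> scd_adj F ((x, \<sigma> x), 0)}
      else {})"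

end

theory Submission
  imports Defs
begin

text \<open>Finiteness of the regularity modulus at \<open>(x, \<sigma> x, 0)\<close> makes all adjoint subspaces at that point
  graphs over the \<open>y\<^sup>*\<close>-component. Since the Grassmannian is compact and the SC derivative has a closed
  graph, the modulus is uniformly bounded near the point, so \<open>\<Psi>\<close> is locally bounded. Testing the
  semismooth* inequality with \<open>(Z p, X p, p)\<close> for \<open>p = \<sigma> x - \<sigma> u + X\<^sup>T (x - u)\<close> bounds \<open>\<parallel>p\<parallel>\<close> by a
  small multiple of \<open>\<parallel>x - u\<parallel> + \<parallel>\<sigma> x - \<sigma> u\<parallel>\<close>; absorbing the last term yields semismoothness of
  \<open>\<sigma>\<close>. The second part is a chain rule.\<close>

section \<open>Orthogonal projections onto subspaces\<close>

lemma dim_orthogonal_comp: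
  fixes L :: "'c::euclidean_space set"
  assumes "subspace L"
  shows "dim (orthogonal_comp L) + dim L = DIM('c)"
  using dim_subspace_orthogonal_to_vectors[OF assms subspace_UNIV]
  by (simp add: orthogonal_comp_def)

text \<open>Two candidates differ by a vector that lies both in \<open>L\<close> and in its
  orthogonal complement, hence by zero. As \<open>orth_proj\<close> is a definite description, its
  values are computed below through this rule.\<close>

lemma orth_projI:
  fixes L :: "'c::euclidean_space set"
  assumes "subspace L" "p \<in> L" "z - p \<in> orthogonal_comp L"
  shows "orth_proj L z = p"
  unfolding orth_proj_def
proof (rule the_equality)
  show "p \<in> L \<and> z - p \<in> orthogonal_comp L"
    using assms by simp
next
  fix q assume q: "q \<in> L \<and> z - q \<in> orthogonal_comp L"
  then have "p - q \<in> L" "(z - q) - (z - p) \<in> orthogonal_comp L"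
    using assms subspace_diff subspace_orthogonal_comp by blast+
  then have "(p - q) \<bullet> (p - q) = 0"
    unfolding orthogonal_comp_def orthogonal_def by auto
  then show "q = p"
    by simp
qed

lemma orth_proj_works:
  fixes L :: "'c::euclidean_space set"
  assumes "subspace L"
  shows "orth_proj L z \<in> L" "z - orth_proj L z \<in> orthogonal_comp L"
proof -
  obtain y w where "y \<in> span L" "\<And>v. v \<in> span L \<Longrightarrow> orthogonal w v" "z = y + w"
    using orthogonal_subspace_decomp_exists by blast
  then have "y \<in> L \<and> z - y \<in> orthogonal_comp L"
    using assms by (auto simp: span_eq_iff[THEN iffD2] orthogonal_comp_def orthogonal_commute)
  then show "orth_proj L z \<in> L" "z - orth_proj L z \<in> orthogonal_comp L"
    using orth_projI[OF assms] by metis+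
qed

lemma orth_proj_fixes_iff:
  fixes L :: "'c::euclidean_space set"
  assumes "subspace L"
  shows "orth_proj L z = z \<longleftrightarrow> z \<in> L"
proof
  assume "orth_proj L z = z"
  then show "z \<in> L"
    using orth_proj_works(1)[OF assms] by metis
next
  assume "z \<in> L"
  then show "orth_proj L z = z"
    using orth_projI[OF assms, of z z] subspace_0[OF subspace_orthogonal_comp, of L] by simp
qed

lemma orth_proj_eq_0_iff:
  fixes L :: "'c::euclidean_space set"
  assumes "subspace L"
  shows "orth_proj L z = 0 \<longleftrightarrow> z \<in> orthogonal_comp L"
  using orth_projI[OF assms, of 0 z] subspace_0[OF assms] orth_proj_works(2)[OF assms, of z]
  by auto

lemma inner_orth_proj:
  fixes L :: "'c::euclidean_space set"
  assumes "subspace L"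
  shows "orth_proj L y \<bullet> z = y \<bullet> orth_proj L z"
proof -
  have "orth_proj L y \<bullet> (z - orth_proj L z) = 0" "orth_proj L z \<bullet> (y - orth_proj L y) = 0"
    using orth_proj_works[OF assms] unfolding orthogonal_comp_def orthogonal_def by blast+
  then show ?thesis
    by (simp add: inner_diff_right inner_commute)
qed

lemma bounded_linear_orth_proj:
  fixes L :: "'c::euclidean_space set"
  assumes "subspace L"
  shows "bounded_linear (orth_proj L)"
proof -
  have "linear (orth_proj L)"
  proof (rule linearI)
    fix x y :: 'c and c :: real
    have eq: "x + y - (orth_proj L x + orth_proj L y) = (x - orth_proj L x) + (y - orth_proj L y)"
      by simp
    show "orth_proj L (x + y) = orth_proj L x + orth_proj L y"
      by (rule orth_projI[OF assms])
        (simp_all only: eq orth_proj_works[OF assms] subspace_add subspace_orthogonal_comp assms)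
    show "orth_proj L (c *\<^sub>R x) = c *\<^sub>R orth_proj L x"
      by (rule orth_projI[OF assms])
        (simp_all add: orth_proj_works[OF assms] subspace_scale subspace_orthogonal_comp assms
          flip: scaleR_right_diff_distrib)
  qed
  then show ?thesis
    by (rule linear_conv_bounded_linear[THEN iffD1])
qed

lemma norm_orth_proj_le:
  fixes L :: "'c::euclidean_space set"
  assumes "subspace L"
  shows "norm (orth_proj L z) \<le> norm z"
proof -
  have "orth_proj L z \<bullet> orth_proj L z = z \<bullet> orth_proj L z"
    by (simp add: assms inner_orth_proj orth_proj_fixes_iff[THEN iffD2] orth_proj_works(1))
  then have "norm (orth_proj L z) * norm (orth_proj L z) \<le> norm z * norm (orth_proj L z)"
    using norm_cauchy_schwarz[of z "orth_proj L z"]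
    by (metis power2_eq_square power2_norm_eq_inner)
  then show ?thesis
    by (cases "orth_proj L z = 0") simp_all
qed

section \<open>Projections as operators and the metric on subspaces\<close>

text \<open>Packaging the projection as a bounded operator makes the gap metric an ordinary norm
  distance, so limits and compactness can be taken in a normed space. The value is meaningful for
  subspaces, where \<open>orth_proj L\<close> is bounded linear.\<close>

definition proj_op :: "'c::euclidean_space set \<Rightarrow> 'c \<Rightarrow>\<^sub>L 'c" where
  "proj_op L = Blinfun (orth_proj L)"

lemma blinfun_apply_proj_op:
  fixes L :: "'c::euclidean_space set"
  assumes "subspace L"
  shows "blinfun_apply (proj_op L) = orth_proj L"
  unfolding proj_op_def by (simp add: bounded_linear_Blinfun_apply bounded_linear_orth_proj assms)

lemma norm_proj_op_le:
  fixes L :: "'c::euclidean_space set"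
  assumes "subspace L"
  shows "norm (proj_op L) \<le> 1"
  by (rule norm_blinfun_bound) (simp_all add: blinfun_apply_proj_op assms norm_orth_proj_le)

lemma subspace_dist_eq_dist:
  fixes L M :: "'c::euclidean_space set"
  assumes "subspace L" "subspace M"
  shows "subspace_dist L M = dist (proj_op L) (proj_op M)"
  by (simp add: subspace_dist_def dist_norm norm_blinfun.rep_eq minus_blinfun.rep_eq
      blinfun_apply_proj_op assms)

text \<open>The projection onto \<open>M\<close> is injective on \<open>L\<close>: a vector of
  \<open>L\<close> that it annihilates is reproduced by the difference of the two projections, whose
  norm is below 1, so the vector is zero.\<close>

lemma dim_le_if_dist_proj_op_less_1:
  fixes L M :: "'c::euclidean_space set"
  assumes "subspace L" "subspace M" "dist (proj_op L) (proj_op M) < 1"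
  shows "dim L \<le> dim M"
proof -
  have lin: "linear (orth_proj M)"
    using bounded_linear_orth_proj[OF assms(2)] by (rule bounded_linear.linear)
  have "x = 0" if "x \<in> L" "orth_proj M x = 0" for x
  proof (rule ccontr)
    assume "x \<noteq> 0"
    have "norm (blinfun_apply (proj_op L - proj_op M) x) \<le> norm (proj_op L - proj_op M) * norm x"
      by (rule norm_blinfun)
    also have "\<dots> < norm x"
      using assms(3) \<open>x \<noteq> 0\<close> by (simp add: dist_norm)
    finally show False
      using that assms by (simp add: blinfun.diff_left blinfun_apply_proj_op
          orth_proj_fixes_iff[THEN iffD2])
  qed
  then have "inj_on (orth_proj M) (span L)"
    using lin assms(1) by (subst linear_inj_on_iff_eq_0) (auto simp: span_eq_iff[THEN iffD2])
  then have "dim L = dim (orth_proj M ` L)"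
    using lin by (simp add: dim_image_eq)
  also have "\<dots> \<le> dim M"
    using orth_proj_works(1)[OF assms(2)] by (intro dim_subset) auto
  finally show ?thesis .
qed

section \<open>Compactness of the Grassmannian\<close>

text \<open>By symmetry and idempotence, \<open>z - P z\<close> is orthogonal to every
  \<open>P y\<close>, so \<open>P z\<close> satisfies the characterisation of the projection onto
  the range.\<close>

lemma proj_op_range:
  fixes P :: "'c::euclidean_space \<Rightarrow>\<^sub>L 'c"
  assumes idem: "\<And>z. P (P z) = P z" and sym: "\<And>y z. P y \<bullet> z = y \<bullet> P z"
  shows "subspace (range P)" "proj_op (range P) = P"
proof -
  show sub: "subspace (range P)"
    by (intro linear_subspace_image subspace_UNIV bounded_linear.linear blinfun.bounded_linear_right)
  have "orth_proj (range P) z = P z" for z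
    by (rule orth_projI[OF sub])
      (auto simp: orthogonal_comp_def orthogonal_def sym blinfun.diff_right idem)
  then show "proj_op (range P) = P"
    by (intro blinfun_eqI) (simp add: blinfun_apply_proj_op sub)
qed

text \<open>Orthogonal projections are exactly the symmetric idempotents,
  and nearby projections have ranges of equal dimension, so their set is closed and bounded.\<close>

lemma grassmann_seq_compact:
  fixes Ls :: "nat \<Rightarrow> ('a::euclidean_space \<times> 'b::euclidean_space) set"
  assumes "\<And>k. Ls k \<in> grassmann"
  obtains L r where "L \<in> grassmann" "strict_mono r" "(\<lambda>k. proj_op (Ls (r k))) \<longlonglongrightarrow> proj_op L"
proof -
  have sub: "subspace (Ls k)" for k
    using assms unfolding grassmann_def by blast
  have "bounded (range (\<lambda>k. proj_op (Ls k)))"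
    unfolding bounded_iff by (rule exI[of _ 1]) (auto intro: norm_proj_op_le sub)
  \<comment> \<open>Bounded operators between Euclidean spaces form a finite-dimensional normed
    space, so bounded sequences have convergent subsequences.\<close>
  then obtain P r where r: "strict_mono r" and "((\<lambda>k. proj_op (Ls k)) \<circ> r) \<longlonglongrightarrow> P"
    using bounded_imp_convergent_subsequence by blast
  then have lim: "(\<lambda>k. proj_op (Ls (r k))) \<longlonglongrightarrow> P"
    by (simp add: o_def)
  have lim_apply: "(\<lambda>k. orth_proj (Ls (r k)) z) \<longlonglongrightarrow> P z" for z
    using blinfun.tendsto[OF lim tendsto_const, of z] by (simp add: blinfun_apply_proj_op sub)
  \<comment> \<open>Applying the projections to their own values changes nothing, so both sides are
    limits of the same sequence.\<close>
  have idem: "P (P z) = P z" for z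
  proof (rule LIMSEQ_unique)
    show "(\<lambda>k. orth_proj (Ls (r k)) z) \<longlonglongrightarrow> P (P z)"
      using blinfun.tendsto[OF lim lim_apply, of z]
      by (simp add: blinfun_apply_proj_op sub orth_proj_fixes_iff[THEN iffD2] orth_proj_works(1))
  qed (rule lim_apply)
  have sym: "P y \<bullet> z = y \<bullet> P z" for y z
  proof (rule LIMSEQ_unique)
    show "(\<lambda>k. orth_proj (Ls (r k)) y \<bullet> z) \<longlonglongrightarrow> P y \<bullet> z"
      by (intro tendsto_intros lim_apply)
    show "(\<lambda>k. orth_proj (Ls (r k)) y \<bullet> z) \<longlonglongrightarrow> y \<bullet> P z"
      unfolding inner_orth_proj[OF sub] by (intro tendsto_intros lim_apply)
  qed
  note P = proj_op_range[OF idem sym]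
  \<comment> \<open>A single index at distance below 1 suffices: the dimension inequality in both
    directions gives the limit range the dimension common to all \<open>Ls\<close>.\<close>
  obtain k where "dist (proj_op (Ls (r k))) (proj_op (range P)) < 1"
    using tendstoD[OF lim zero_less_one] unfolding P(2) by (auto simp: eventually_sequentially)
  then have "dim (range P) = dim (Ls (r k))"
    using dim_le_if_dist_proj_op_less_1[OF sub P(1)] dim_le_if_dist_proj_op_less_1[OF P(1) sub]
    by (metis dist_commute le_antisym)
  then have "range P \<in> grassmann"
    using P(1) assms unfolding grassmann_def by simp
  with r lim P(2) that show thesis
    by metis
qed

section \<open>Closed graph of the SC derivative and its adjoint\<close>

text \<open>Trading sequences for an approximation property avoids diagonal sequences later. Tangent
  cones at points of \<open>scd_points\<close> are subspaces, which is what allows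
  \<open>subspace_dist\<close> to be read as a distance of operators.\<close>

lemma scd_iff:
  fixes G :: "'a::euclidean_space \<Rightarrow> 'b::euclidean_space set"
  shows "L \<in> scd G w \<longleftrightarrow> L \<in> grassmann \<and> (\<forall>\<epsilon>>0. \<exists>v \<in> scd_points G.
     dist v w < \<epsilon> \<and> dist (proj_op (tangent_cone (gph G) v)) (proj_op L) < \<epsilon>)"
    (is "_ \<longleftrightarrow> ?R")
proof
  assume "L \<in> scd G w"
  then obtain ws where L: "L \<in> grassmann" and ws: "\<And>k. ws k \<in> scd_points G" "ws \<longlonglongrightarrow> w"
    and lim: "(\<lambda>k. subspace_dist L (tangent_cone (gph G) (ws k))) \<longlonglongrightarrow> 0"
    unfolding scd_def by blast
  have "\<exists>v \<in> scd_points G.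
      dist v w < \<epsilon> \<and> dist (proj_op (tangent_cone (gph G) v)) (proj_op L) < \<epsilon>" if "\<epsilon> > 0" for \<epsilon>
  proof -
    have "\<forall>\<^sub>F k in sequentially. subspace_dist L (tangent_cone (gph G) (ws k)) < \<epsilon> \<and> dist (ws k) w < \<epsilon>"
      using order_tendstoD(2)[OF lim that] tendstoD[OF ws(2) that] by (rule eventually_conj)
    then obtain k where k: "subspace_dist L (tangent_cone (gph G) (ws k)) < \<epsilon>" "dist (ws k) w < \<epsilon>"
      by (auto simp: eventually_sequentially)
    have "subspace (tangent_cone (gph G) (ws k))" "subspace L"
      using ws(1)[of k] L unfolding scd_points_def grassmann_def by auto
    then show ?thesis
      using k ws(1)[of k] by (auto simp: subspace_dist_eq_dist dist_commute)
  qed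
  with L show ?R
    by blast
next
  assume R: ?R
  then have L: "L \<in> grassmann"
    by blast
  from R have "\<forall>k. \<exists>v \<in> scd_points G. dist v w < inverse (real (Suc k)) \<and>
      dist (proj_op (tangent_cone (gph G) v)) (proj_op L) < inverse (real (Suc k))"
    by (metis inverse_Suc)
  then obtain ws where ws: "\<And>k. ws k \<in> scd_points G"
    and less: "\<And>k. dist (ws k) w < inverse (real (Suc k))"
      "\<And>k. dist (proj_op (tangent_cone (gph G) (ws k))) (proj_op L) < inverse (real (Suc k))"
    by metis
  have "subspace (tangent_cone (gph G) (ws k))" "subspace L" for k
    using ws[of k] L unfolding scd_points_def grassmann_def by auto
  then have eq: "subspace_dist L (tangent_cone (gph G) (ws k)) =
      dist (proj_op (tangent_cone (gph G) (ws k))) (proj_op L)" for k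
    by (simp add: subspace_dist_eq_dist dist_commute)
  have "(\<lambda>k. dist (ws k) w) \<longlonglongrightarrow> 0"
    by (rule tendsto_0_le[OF LIMSEQ_inverse_real_of_nat, of _ 1])
      (intro always_eventually allI, use less(1) in \<open>simp add: less_imp_le\<close>)
  then have "ws \<longlonglongrightarrow> w"
    by (rule tendsto_dist_iff[THEN iffD2])
  moreover have "(\<lambda>k. subspace_dist L (tangent_cone (gph G) (ws k))) \<longlonglongrightarrow> 0"
    unfolding eq by (rule tendsto_0_le[OF LIMSEQ_inverse_real_of_nat, of _ 1])
      (intro always_eventually allI, use less(2) in \<open>simp add: less_imp_le\<close>)
  ultimately show "L \<in> scd G w"
    using L ws unfolding scd_def by blast
qed

text \<open>A subspace close to \<open>L\<close> at a base point close to \<open>w\<close> is itself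
  approximated by tangent cones; two halves of \<epsilon> and the triangle inequality
  finish.\<close>

lemma scd_limit:
  fixes G :: "'a::euclidean_space \<Rightarrow> 'b::euclidean_space set"
  assumes "\<And>k. Ls k \<in> scd G (ws k)" "L \<in> grassmann" "ws \<longlonglongrightarrow> w"
    "(\<lambda>k. proj_op (Ls k)) \<longlonglongrightarrow> proj_op L"
  shows "L \<in> scd G w"
  unfolding scd_iff
proof (intro conjI allI impI)
  fix \<epsilon> :: real assume "\<epsilon> > 0"
  then have "\<epsilon> / 2 > 0"
    by simp
  then have "\<forall>\<^sub>F k in sequentially. dist (ws k) w < \<epsilon> / 2 \<and> dist (proj_op (Ls k)) (proj_op L) < \<epsilon> / 2"
    using assms(3,4) by (intro eventually_conj tendstoD)
  then obtain k where k: "dist (ws k) w < \<epsilon> / 2" "dist (proj_op (Ls k)) (proj_op L) < \<epsilon> / 2"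
    by (auto simp: eventually_sequentially)
  obtain v where "v \<in> scd_points G" "dist v (ws k) < \<epsilon> / 2"
      "dist (proj_op (tangent_cone (gph G) v)) (proj_op (Ls k)) < \<epsilon> / 2"
    using assms(1)[of k] \<open>\<epsilon> / 2 > 0\<close> unfolding scd_iff by blast
  with k show "\<exists>v \<in> scd_points G.
      dist v w < \<epsilon> \<and> dist (proj_op (tangent_cone (gph G) v)) (proj_op L) < \<epsilon>"
    by (metis dist_triangle_half_r dist_commute)
qed (rule assms(2))

text \<open>Orthogonality to \<open>L\<close> means being annihilated by the projection. Stated as
  an equation in the operator and the vector, membership survives limits in both.\<close>

lemma mem_adjoint_subspace_iff:
  fixes L :: "('a::euclidean_space \<times> 'b::euclidean_space) set"
  assumes "subspace L"
  shows "(z, u) \<in> adjoint_subspace L \<longleftrightarrow> blinfun_apply (proj_op L) (u, - z) = 0"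
  unfolding adjoint_subspace_def blinfun_apply_proj_op[OF assms] orth_proj_eq_0_iff[OF assms]
  by (auto intro!: exI[of _ "- z"])

lemma adjoint_subspace_eq_image:
  "adjoint_subspace L = (\<lambda>(u, v). (- v, u)) ` orthogonal_comp L"
  unfolding adjoint_subspace_def by auto

text \<open>The adjoint is an injective linear image of the orthogonal complement, whose dimension
  is that of the second factor.\<close>

lemma adjoint_subspace_grassmann:
  fixes L :: "('a::euclidean_space \<times> 'b::euclidean_space) set"
  assumes "L \<in> grassmann"
  shows "adjoint_subspace L \<in> grassmann"
proof -
  have L: "subspace L" "dim L = DIM('a)"
    using assms unfolding grassmann_def by auto
  let ?f = "\<lambda>(u, v). (- v, u) :: 'b \<times> 'a"
  have lin: "linear ?f"
    by (rule linearI) auto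
  have "inj ?f"
    by (auto simp: inj_on_def)
  then have "dim (adjoint_subspace L) = dim (orthogonal_comp L)"
    unfolding adjoint_subspace_eq_image using lin by (intro dim_image_eq) (auto intro: inj_on_subset)
  then have "dim (adjoint_subspace L) = DIM('b)"
    using dim_orthogonal_comp[OF L(1)] L(2) by simp
  moreover have "subspace (adjoint_subspace L)"
    unfolding adjoint_subspace_eq_image
    by (intro linear_subspace_image lin subspace_orthogonal_comp)
  ultimately show ?thesis
    unfolding grassmann_def by simp
qed

lemma scd_adj_grassmann:
  assumes "L \<in> scd_adj G w"
  shows "L \<in> grassmann"
  using assms adjoint_subspace_grassmann unfolding scd_adj_def scd_def by blast

text \<open>The subspaces containing the given vectors may be chosen without any relation to each
  other; compactness of the Grassmannian provides a subsequence along which they converge, and the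
  limit subspace belongs to the SC derivative at \<open>w\<close>.\<close>

lemma scd_adj_limit:
  fixes G :: "'a::euclidean_space \<Rightarrow> 'b::euclidean_space set"
  assumes "\<And>k. vs k \<in> \<Union>(scd_adj G (ws k))" "ws \<longlonglongrightarrow> w" "vs \<longlonglongrightarrow> v"
  shows "v \<in> \<Union>(scd_adj G w)"
proof -
  have "\<forall>k. \<exists>L \<in> scd G (ws k). vs k \<in> adjoint_subspace L"
    using assms(1) unfolding scd_adj_def by blast
  then obtain Ls where Ls: "\<And>k. Ls k \<in> scd G (ws k)" "\<And>k. vs k \<in> adjoint_subspace (Ls k)"
    by metis
  then have gr: "Ls k \<in> grassmann" for k
    unfolding scd_def by blast
  then obtain L r where L: "L \<in> grassmann" and r: "strict_mono r"
    and lim: "(\<lambda>k. proj_op (Ls (r k))) \<longlonglongrightarrow> proj_op L"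
    using grassmann_seq_compact by blast
  have "(\<lambda>k. ws (r k)) \<longlonglongrightarrow> w" and vs: "(\<lambda>k. vs (r k)) \<longlonglongrightarrow> v"
    using LIMSEQ_subseq_LIMSEQ[OF assms(2) r] LIMSEQ_subseq_LIMSEQ[OF assms(3) r]
    by (simp_all add: o_def)
  then have "L \<in> scd G w"
    using scd_limit[of "\<lambda>k. Ls (r k)" G "\<lambda>k. ws (r k)", OF Ls(1) L _ lim] by blast
  moreover have "v \<in> adjoint_subspace L"
  proof -
    have sub: "subspace L" "subspace (Ls k)" for k
      using L gr unfolding grassmann_def by auto
    \<comment> \<open>Operators and arguments vary at once; evaluation is jointly continuous, so the
      membership equation passes to the limit.\<close>
    have "(\<lambda>k. proj_op (Ls (r k)) (snd (vs (r k)), - fst (vs (r k))))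
        \<longlonglongrightarrow> proj_op L (snd v, - fst v)"
      by (intro tendsto_intros lim vs)
    moreover have "proj_op (Ls k) (snd (vs k), - fst (vs k)) = 0" for k
      using Ls(2)[of k] mem_adjoint_subspace_iff[OF sub(2)] by (metis prod.collapse)
    ultimately have "proj_op L (snd v, - fst v) = 0"
      by (simp add: LIMSEQ_const_iff)
    then show ?thesis
      using mem_adjoint_subspace_iff[OF sub(1)] by (metis prod.collapse)
  qed
  ultimately show ?thesis
    unfolding scd_adj_def by blast
qed

section \<open>Consequences of a finite regularity modulus\<close>

text \<open>A nonzero vector of this form could be scaled freely inside its subspace while the last
  component stays 0, making the supremum infinite.\<close>

lemma scd_reg_finite_imp_injective:
  fixes F :: "'a::euclidean_space \<times> 'b::euclidean_space \<Rightarrow> 'c::euclidean_space set"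
  assumes "scd_reg F w < \<infinity>" "(z, (x, 0)) \<in> \<Union>(scd_adj F w)"
  shows "(z, x) = 0"
proof (rule ccontr)
  assume "(z, x) \<noteq> 0"
  then have pos: "norm (z, x) > 0"
    by simp
  obtain L where L: "L \<in> scd_adj F w" "(z, (x, 0)) \<in> L"
    using assms(2) by blast
  then have "subspace L"
    using scd_adj_grassmann unfolding grassmann_def by blast
  have le: "ereal (t * norm (z, x)) \<le> scd_reg F w" if "t \<ge> 0" for t
  proof -
    have "t *\<^sub>R (z, (x, 0)) \<in> L"
      using \<open>subspace L\<close> L(2) by (rule subspace_scale)
    then have "ereal (norm (t *\<^sub>R (z, x))) \<le> scd_reg F w"
      unfolding scd_reg_def using L(1)
      by (intro Sup_upper CollectI exI[of _ "t *\<^sub>R z"] exI[of _ "t *\<^sub>R x"] exI[of _ 0]) auto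
    then show ?thesis
      using that norm_scaleR[of t "(z, x)"] by simp
  qed
  have "scd_reg F w \<ge> ereal r" for r
  proof -
    have "r \<le> max 0 r"
      by simp
    then show ?thesis
      \<comment> \<open>This nonnegative factor scales the norm to exactly \<open>max 0 r\<close>,
        which dominates \<open>r\<close>.\<close>
      using le[of "max 0 r / norm (z, x)"] pos by (auto intro: order_trans[rotated])
  qed
  then show False
    using assms(1) by (metis ereal_top less_irrefl)
qed

text \<open>Otherwise normalised violating vectors accumulate, by compactness of the Grassmannian, at some
  \<open>(z, x, 0)\<close> with \<open>\<parallel>(z, x)\<parallel> = 1\<close> in the limiting adjoint.\<close>

lemma scd_reg_locally_bounded:
  fixes F :: "'a::euclidean_space \<times> 'b::euclidean_space \<Rightarrow> 'c::euclidean_space set"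
  assumes "scd_reg F w < \<infinity>"
  obtains r \<kappa> where "r > 0" "\<kappa> > 0"
    "\<And>v z x y. \<lbrakk>dist v w < r; (z, (x, y)) \<in> \<Union>(scd_adj F v)\<rbrakk> \<Longrightarrow> norm (z, x) \<le> \<kappa> * norm y"
proof -
  have "\<exists>r>0. \<exists>\<kappa>>0. \<forall>v z x y. dist v w < r \<longrightarrow> (z, (x, y)) \<in> \<Union>(scd_adj F v) \<longrightarrow>
     norm (z, x) \<le> \<kappa> * norm y"
  proof (rule ccontr)
    assume contra: "\<not> ?thesis"
    \<comment> \<open>Negating the claim for radius 1/(k+1) and constant k+1 gives a violating
      vector. Dividing it by the norm of its first two components keeps it in the subspace and makes
      the last component small.\<close>
    have "\<exists>v z x y. dist v w < inverse (real (Suc k)) \<and> (z, (x, y)) \<in> \<Union>(scd_adj F v) \<and>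
        norm (z, x) = 1 \<and> norm y < inverse (real (Suc k))" for k
    proof -
      let ?e = "inverse (real (Suc k))"
      have "?e > 0" "real (Suc k) > 0"
        by simp_all
      with contra obtain v z x y where v: "dist v w < ?e" "(z, (x, y)) \<in> \<Union>(scd_adj F v)"
        and gt: "norm (z, x) > real (Suc k) * norm y"
        by (metis linorder_not_le)
      define c where "c = inverse (norm (z, x))"
      have "norm (z, x) > 0"
        using gt by (rule le_less_trans[rotated]) simp
      then have c: "c > 0" "c * norm (z, x) = 1"
        by (simp_all add: c_def)
      obtain L where L: "L \<in> scd_adj F v" "(z, (x, y)) \<in> L"
        using v(2) by blast
      then have "c *\<^sub>R (z, (x, y)) \<in> L"
        using scd_adj_grassmann unfolding grassmann_def by (blast intro: subspace_scale)
      then have "(c *\<^sub>R z, (c *\<^sub>R x, c *\<^sub>R y)) \<in> \<Union>(scd_adj F v)"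
        using L(1) by auto
      moreover have "norm (c *\<^sub>R z, c *\<^sub>R x) = 1"
        using c norm_scaleR[of c "(z, x)"] by simp
      moreover have "norm (c *\<^sub>R y) < ?e"
        using mult_strict_left_mono[OF gt c(1)] c by (simp add: field_simps)
      ultimately show ?thesis
        using v(1) by blast
    qed
    then obtain vs zs xs ys where vs: "\<And>k. dist (vs k) w < inverse (real (Suc k))"
      and mem: "\<And>k. (zs k, (xs k, ys k)) \<in> \<Union>(scd_adj F (vs k))"
      and norm1: "\<And>k. norm (zs k, xs k) = 1" and ys: "\<And>k. norm (ys k) < inverse (real (Suc k))"
      by metis
    have "bounded (range (\<lambda>k. (zs k, xs k)))"
      unfolding bounded_iff by (rule exI[of _ 1]) (simp add: norm1)
    then obtain zx r where r: "strict_mono r" and "((\<lambda>k. (zs k, xs k)) \<circ> r) \<longlonglongrightarrow> zx"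
      using bounded_imp_convergent_subsequence by blast
    then have lim: "(\<lambda>k. (zs (r k), xs (r k))) \<longlonglongrightarrow> zx"
      by (simp add: o_def)
    have "(\<lambda>k. dist (vs k) w) \<longlonglongrightarrow> 0"
      by (rule tendsto_0_le[OF LIMSEQ_inverse_real_of_nat, of _ 1])
        (intro always_eventually allI, use vs in \<open>simp add: less_imp_le\<close>)
    then have "vs \<longlonglongrightarrow> w"
      by (rule tendsto_dist_iff[THEN iffD2])
    then have vs_lim: "(\<lambda>k. vs (r k)) \<longlonglongrightarrow> w"
      using LIMSEQ_subseq_LIMSEQ[OF _ r] by (auto simp: o_def)
    have "ys \<longlonglongrightarrow> 0"
      by (rule tendsto_0_le[OF LIMSEQ_inverse_real_of_nat, of _ 1])
        (intro always_eventually allI, use ys in \<open>simp add: less_imp_le\<close>)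
    then have ys_lim: "(\<lambda>k. ys (r k)) \<longlonglongrightarrow> 0"
      using LIMSEQ_subseq_LIMSEQ[OF _ r] by (auto simp: o_def)
    \<comment> \<open>The limit has last component 0, so injectivity at \<open>w\<close> forces it
      to vanish, against norm 1.\<close>
    have "(\<lambda>k. (zs (r k), (xs (r k), ys (r k)))) \<longlonglongrightarrow> (fst zx, (snd zx, 0))"
      using tendsto_fst[OF lim] tendsto_snd[OF lim] ys_lim by (intro tendsto_Pair) simp_all
    then have "(fst zx, (snd zx, 0)) \<in> \<Union>(scd_adj F w)"
      using scd_adj_limit[of "\<lambda>k. (zs (r k), (xs (r k), ys (r k)))", OF mem vs_lim] by blast
    then have "zx = 0"
      using scd_reg_finite_imp_injective[OF assms] by (metis prod.collapse)
    moreover have "norm zx = 1"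
      using tendsto_norm[OF lim] norm1 by (simp add: LIMSEQ_const_iff)
    ultimately show False
      by simp
  qed
  then show thesis
    using that by metis
qed

text \<open>Projection to the last component is injective on \<open>L\<close>, and \<open>L\<close>
  has the dimension of the target, so it is bijective. The other two components of its inverse are
  the linear maps behind \<open>Z\<close> and \<open>X_mat L\<close>.\<close>

lemma scd_adj_representation:
  fixes F :: "(real^'n) \<times> (real^'m) \<Rightarrow> (real^'m) set"
  assumes "scd_reg F w < \<infinity>" "L \<in> scd_adj F w"
  obtains Z :: "real^'m^'m" where "L = {(Z *v p, X_mat L *v p, p) |p. True}"
proof -
  have L: "subspace L" "dim L = CARD('m)"
    using scd_adj_grassmann[OF assms(2)] unfolding grassmann_def by auto
  let ?f = "\<lambda>v :: (real^'m) \<times> (real^'n) \<times> (real^'m). snd (snd v)"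
  have lin: "linear ?f"
    by (rule linearI) auto
  have "v = 0" if "v \<in> L" "?f v = 0" for v
    using scd_reg_finite_imp_injective[OF assms(1), of "fst v" "fst (snd v)"] that assms(2)
    by (cases v) (auto simp: zero_prod_def)
  then have inj: "inj_on ?f (span L)"
    using L(1) lin by (subst linear_inj_on_iff_eq_0) (auto simp: span_eq_iff[THEN iffD2])
  then obtain g where g: "range g \<subseteq> L" "linear g" "\<And>v. v \<in> L \<Longrightarrow> g (?f v) = v"
    using linear_exists_left_inverse_on[OF lin L(1)] L(1) by (auto simp: span_eq_iff[THEN iffD2])
  have "dim (?f ` L) = DIM(real^'m)"
    using dim_image_eq[OF lin inj] L(2) by simp
  then have "?f ` L = UNIV"
    unfolding dim_eq_full by (simp add: span_eq_iff[THEN iffD2] linear_subspace_image[OF lin L(1)])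
  \<comment> \<open>The left inverse \<open>g\<close> on \<open>L\<close> is also a right inverse
    because the projection maps \<open>L\<close> onto the whole space.\<close>
  then have fg: "?f (g p) = p" for p
  proof -
    have "p \<in> ?f ` L"
      using \<open>?f ` L = UNIV\<close> by simp
    then obtain v where "v \<in> L" "p = ?f v"
      by blast
    then show ?thesis
      using g(3) by simp
  qed
  define Z where "Z = matrix (\<lambda>p. fst (g p))"
  define X where "X = matrix (\<lambda>p. fst (snd (g p)))"
  have "linear (\<lambda>p. fst (g p))" "linear (\<lambda>p. fst (snd (g p)))"
    using g(2) by (auto intro!: linearI simp: linear_add linear_cmul)
  then have "Z *v p = fst (g p)" "X *v p = fst (snd (g p))" for p
    unfolding Z_def X_def by (simp_all add: matrix_works)
  then have gp: "g p = (Z *v p, X *v p, p)" for p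
    using fg[of p] by (simp add: prod_eq_iff)
  have "L = range g"
  proof
    show "L \<subseteq> range g"
      using g(3) by (metis rangeI subsetI)
  qed (rule g(1))
  then have eq: "L = {(Z *v p, X *v p, p) |p. True}"
    by (auto simp: full_SetCompr_eq gp)
  show thesis
    by (rule that[of Z], subst X_mat_eqI[OF eq]) (rule eq)
qed

section \<open>Auxiliary facts on inner products and matrices\<close>

lemma norm_le_if_inner_le:
  fixes a b :: "'a::real_inner"
  assumes "a \<bullet> a \<le> c * norm a" "0 \<le> c"
  shows "norm a \<le> c"
proof (cases "a = 0")
  case False
  have "norm a * norm a \<le> c * norm a"
    using assms(1) by (simp add: power2_norm_eq_inner flip: power2_eq_square)
  then show ?thesis
    using False by simp
qed (use assms in simp)

lemma blinfun_apply_matrix_op [simp]: "blinfun_apply (matrix_op A) = (*v) A"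
  unfolding matrix_op_def by (simp add: bounded_linear_Blinfun_apply matrix_vector_mul_bounded_linear)

lemma minus_matrix_vector_mult:
  fixes A :: "real^'n^'m"
  shows "(- A) *v x = - (A *v x)"
  by (simp add: vec_eq_iff matrix_vector_mult_def sum_negf)

lemma inner_transpose_matrix:
  fixes A :: "real^'n^'m"
  shows "(transpose A *v x) \<bullet> y = x \<bullet> (A *v y)"
  by (simp add: dot_lmul_matrix)

section \<open>Semismoothness in epsilon-delta form\<close>

text \<open>A bound uniform over \<open>\<Psi> v\<close> controls the real supremum from above
  because the set is nonempty near \<open>u\<close>, and the same bound makes it bounded, so that
  the supremum is also nonnegative.\<close>

lemma semismooth_atI:
  fixes f :: "'a::euclidean_space \<Rightarrow> 'b::euclidean_space"
  assumes "u \<in> interior {v. \<Psi> v \<noteq> {}}"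
    and "r > 0" "\<And>v A. \<lbrakk>v \<in> ball u r; A \<in> \<Psi> v\<rbrakk> \<Longrightarrow> norm A \<le> B"
    and small: "\<And>\<epsilon>. \<epsilon> > 0 \<Longrightarrow> \<exists>\<delta>>0. \<forall>v \<in> U. norm (v - u) < \<delta> \<longrightarrow>
      (\<forall>A \<in> \<Psi> v. norm (f v - f u - blinfun_apply A (v - u)) \<le> \<epsilon> * norm (v - u))"
  shows "semismooth_at f U \<Psi> u"
  unfolding semismooth_at_def
proof (intro conjI)
  show "\<exists>r>0. \<exists>B. \<forall>v \<in> ball u r. \<forall>A \<in> \<Psi> v. norm A \<le> B"
    using assms(2,3) by blast
  let ?S = "\<lambda>v. SUP A \<in> \<Psi> v. norm (f v - f u - blinfun_apply A (v - u))"
  show "((\<lambda>v. ?S v / norm (v - u)) \<longlongrightarrow> 0) (at u within U)"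
    unfolding tendsto_iff eventually_at
  proof (intro allI impI)
    fix \<epsilon> :: real assume "\<epsilon> > 0"
    then obtain \<delta> where "\<delta> > 0" and \<delta>: "\<And>v A. \<lbrakk>v \<in> U; norm (v - u) < \<delta>; A \<in> \<Psi> v\<rbrakk> \<Longrightarrow>
        norm (f v - f u - blinfun_apply A (v - u)) \<le> \<epsilon> / 2 * norm (v - u)"
      \<comment> \<open>Suprema preserve only weak inequalities; halving restores the strict
        one.\<close>
      using small[of "\<epsilon> / 2"] by auto
    obtain s where "s > 0" and s: "\<And>v. dist v u < s \<Longrightarrow> \<Psi> v \<noteq> {}"
      using assms(1) unfolding mem_interior by (auto simp: subset_iff dist_commute)
    have "dist (?S v / norm (v - u)) 0 < \<epsilon>" if v: "v \<in> U" "v \<noteq> u" "dist v u < min \<delta> s" for v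
    proof -
      have bound: "norm (f v - f u - blinfun_apply A (v - u)) \<le> \<epsilon> / 2 * norm (v - u)"
        if "A \<in> \<Psi> v" for A
        using \<delta> v that by (simp add: dist_norm)
      have "\<Psi> v \<noteq> {}"
        using s v by simp
      then obtain A where A: "A \<in> \<Psi> v"
        by blast
      have "?S v \<le> \<epsilon> / 2 * norm (v - u)"
        using \<open>\<Psi> v \<noteq> {}\<close> bound by (rule cSUP_least)
      moreover have "0 \<le> ?S v"
        using A bound by (intro cSUP_upper2[OF _ A] bdd_aboveI2[where M = "\<epsilon> / 2 * norm (v - u)"]) auto
      moreover have "norm (v - u) > 0"
        using v by simp
      ultimately have "\<bar>?S v / norm (v - u)\<bar> \<le> \<epsilon> / 2"
        by (simp add: pos_divide_le_eq)
      then show ?thesis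
        using \<open>\<epsilon> > 0\<close> unfolding dist_real_def by linarith
    qed
    then show "\<exists>d>0. \<forall>v \<in> U. v \<noteq> u \<and> dist v u < d \<longrightarrow> dist (?S v / norm (v - u)) 0 < \<epsilon>"
      using \<open>\<delta> > 0\<close> \<open>s > 0\<close> by (intro exI[of _ "min \<delta> s"]) auto
  qed
qed (rule assms(1))

text \<open>To recover individual elements from the supremum, the set of errors must be bounded
  above; this follows from the local boundedness of \<open>\<Psi>\<close>.\<close>

lemma semismooth_atE:
  fixes f :: "'a::euclidean_space \<Rightarrow> 'b::euclidean_space"
  assumes "semismooth_at f U \<Psi> u"
  obtains r B where "r > 0" "B > 0"
    "\<And>v A. \<lbrakk>dist v u < r; A \<in> \<Psi> v\<rbrakk> \<Longrightarrow> norm A \<le> B"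
    "\<And>v. dist v u < r \<Longrightarrow> \<Psi> v \<noteq> {}"
    "\<And>\<epsilon>. \<epsilon> > 0 \<Longrightarrow> \<exists>\<delta>>0. \<forall>v \<in> U. norm (v - u) < \<delta> \<longrightarrow>
      (\<forall>A \<in> \<Psi> v. norm (f v - f u - blinfun_apply A (v - u)) \<le> \<epsilon> * norm (v - u))"
proof -
  have "\<exists>r>0. \<exists>B. \<forall>v \<in> ball u r. \<forall>A \<in> \<Psi> v. norm A \<le> B"
    using assms unfolding semismooth_at_def by simp
  then obtain r B where "r > 0" and B: "\<And>v A. \<lbrakk>dist u v < r; A \<in> \<Psi> v\<rbrakk> \<Longrightarrow> norm A \<le> B"
    unfolding Ball_def mem_ball by blast
  obtain s where "s > 0" and s: "\<And>v. dist u v < s \<Longrightarrow> \<Psi> v \<noteq> {}"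
    using assms unfolding semismooth_at_def mem_interior by (auto simp: subset_iff)
  let ?S = "\<lambda>v. SUP A \<in> \<Psi> v. norm (f v - f u - blinfun_apply A (v - u))"
  have small: "\<exists>\<delta>>0. \<forall>v \<in> U. norm (v - u) < \<delta> \<longrightarrow>
      (\<forall>A \<in> \<Psi> v. norm (f v - f u - blinfun_apply A (v - u)) \<le> \<epsilon> * norm (v - u))"
    if "\<epsilon> > 0" for \<epsilon>
  proof -
    have "((\<lambda>v. ?S v / norm (v - u)) \<longlongrightarrow> 0) (at u within U)"
      using assms unfolding semismooth_at_def by blast
    then obtain \<delta> where "\<delta> > 0"
      and \<delta>: "\<And>v. \<lbrakk>v \<in> U; v \<noteq> u; dist v u < \<delta>\<rbrakk> \<Longrightarrow> dist (?S v / norm (v - u)) 0 < \<epsilon>"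
      using \<open>\<epsilon> > 0\<close> unfolding tendsto_iff eventually_at by metis
    have "norm (f v - f u - blinfun_apply A (v - u)) \<le> \<epsilon> * norm (v - u)"
      if v: "v \<in> U" "norm (v - u) < min \<delta> r" and A: "A \<in> \<Psi> v" for v A
    \<comment> \<open>The limit says nothing at \<open>v = u\<close>, but there the error is
      zero.\<close>
    proof (cases "v = u")
      case False
      have bdd: "bdd_above ((\<lambda>A. norm (f v - f u - blinfun_apply A (v - u))) ` \<Psi> v)"
      proof (rule bdd_aboveI2)
        fix A assume "A \<in> \<Psi> v"
        moreover have "dist u v < r"
          using v by (simp add: dist_norm norm_minus_commute)
        ultimately have "norm A \<le> B"
          using B by blast
        then have "norm (blinfun_apply A (v - u)) \<le> B * norm (v - u)"
          using norm_blinfun[of A "v - u"] by (meson mult_right_mono norm_ge_zero order_trans)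
        then show "norm (f v - f u - blinfun_apply A (v - u)) \<le> norm (f v - f u) + B * norm (v - u)"
          using norm_triangle_ineq4[of "f v - f u" "blinfun_apply A (v - u)"] by linarith
      qed
      have "?S v / norm (v - u) < \<epsilon>"
        using \<delta>[OF v(1) False] v(2) unfolding dist_real_def dist_norm by linarith
      then have "?S v \<le> \<epsilon> * norm (v - u)"
        using False by (simp add: divide_less_eq less_imp_le)
      then show ?thesis
        using cSUP_upper[OF A bdd] by linarith
    qed simp
    then show ?thesis
      using \<open>\<delta> > 0\<close> \<open>r > 0\<close> by (intro exI[of _ "min \<delta> r"]) auto
  qed
  show thesis
  \<comment> \<open>Enlarging the bound to at least 1 makes it positive, so that it may serve as a
    divisor.\<close>
  proof (rule that[of "min r s" "max B 1"])
    show "norm A \<le> max B 1" if "dist v u < min r s" "A \<in> \<Psi> v" for v A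
      using B[of v A] that by (simp add: dist_commute le_max_iff_disj)
    show "\<Psi> v \<noteq> {}" if "dist v u < min r s" for v
      using s that by (simp add: dist_commute)
  qed (use \<open>r > 0\<close> \<open>s > 0\<close> small in auto)
qed

text \<open>Any single \<open>A\<close> in the nonempty set \<open>\<Psi> v\<close> suffices: its
  action is bounded by \<open>B\<close>, and the error is bounded with constant 1.\<close>

lemma semismooth_at_imp_calm:
  fixes f :: "'a::euclidean_space \<Rightarrow> 'b::euclidean_space"
  assumes "semismooth_at f U \<Psi> u"
  obtains \<delta> C where "\<delta> > 0" "C > 0"
    "\<And>v. \<lbrakk>v \<in> U; norm (v - u) < \<delta>\<rbrakk> \<Longrightarrow> norm (f v - f u) \<le> C * norm (v - u)"
proof (rule semismooth_atE[OF assms])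
  fix r B assume "r > 0" "B > 0"
    and B: "\<And>v A. \<lbrakk>dist v u < r; A \<in> \<Psi> v\<rbrakk> \<Longrightarrow> norm A \<le> B"
    and ne: "\<And>v. dist v u < r \<Longrightarrow> \<Psi> v \<noteq> {}"
    and small: "\<And>\<epsilon>. \<epsilon> > 0 \<Longrightarrow> \<exists>\<delta>>0. \<forall>v \<in> U. norm (v - u) < \<delta> \<longrightarrow>
      (\<forall>A \<in> \<Psi> v. norm (f v - f u - blinfun_apply A (v - u)) \<le> \<epsilon> * norm (v - u))"
  obtain \<delta> where "\<delta> > 0" and \<delta>: "\<And>v A. \<lbrakk>v \<in> U; norm (v - u) < \<delta>; A \<in> \<Psi> v\<rbrakk> \<Longrightarrow>
      norm (f v - f u - blinfun_apply A (v - u)) \<le> norm (v - u)"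
    using small[OF zero_less_one] by auto
  have "norm (f v - f u) \<le> (1 + B) * norm (v - u)" if v: "v \<in> U" "norm (v - u) < min \<delta> r" for v
  proof -
    obtain A where A: "A \<in> \<Psi> v"
      using ne v by (fastforce simp: dist_norm)
    moreover have "dist v u < r"
      using v by (simp add: dist_norm)
    ultimately have "norm A \<le> B"
      using B by blast
    then have "norm (blinfun_apply A (v - u)) \<le> B * norm (v - u)"
      using norm_blinfun[of A "v - u"] by (meson mult_right_mono norm_ge_zero order_trans)
    moreover have "norm (f v - f u - blinfun_apply A (v - u)) \<le> norm (v - u)"
      using \<delta> v A by simp
    ultimately show ?thesis
      using norm_triangle_sub[of "f v - f u" "blinfun_apply A (v - u)"]
      by (simp add: distrib_right)
  qed
  then show thesis
    using that[of "min \<delta> r" "1 + B"] \<open>\<delta> > 0\<close> \<open>r > 0\<close> \<open>B > 0\<close> by simp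
qed

section \<open>Chain rule along the graph of a semismooth mapping\<close>

text \<open>The block operator with rows identity and \<open>A\<close>: it plays the role of a
  generalized derivative of \<open>x \<mapsto> (x, \<sigma> x)\<close> when \<open>A\<close> does so
  for \<sigma>.\<close>

definition graph_op :: "('a::euclidean_space \<Rightarrow>\<^sub>L 'b::euclidean_space) \<Rightarrow> 'a \<Rightarrow>\<^sub>L ('a \<times> 'b)" where
  "graph_op A = Blinfun (\<lambda>v. (v, blinfun_apply A v))"

lemma blinfun_apply_graph_op [simp]: "blinfun_apply (graph_op A) v = (v, blinfun_apply A v)"
  unfolding graph_op_def
  by (subst bounded_linear_Blinfun_apply)
    (auto intro!: bounded_linear_Pair bounded_linear_ident blinfun.bounded_linear_right)

lemma norm_graph_op_le: "norm (graph_op A) \<le> 1 + norm A"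
proof (rule norm_blinfun_bound)
  show "norm (blinfun_apply (graph_op A) v) \<le> (1 + norm A) * norm v" for v
    using norm_Pair_le[of v "blinfun_apply A v"] norm_blinfun[of A v]
    by (simp add: distrib_right)
qed simp

text \<open>The error splits into the error of \<phi> at the graph point and the image under
  \<open>C\<close> of the error of \<sigma>. Calmness of \<sigma> makes the displacement along the
  graph comparable to that of \<open>x\<close>, and \<open>C\<close> is locally bounded.\<close>

lemma semismooth_at_compose_graph:
  fixes \<sigma> :: "'a::euclidean_space \<Rightarrow> 'b::euclidean_space"
    and \<phi> :: "'a \<times> 'b \<Rightarrow> 'c::euclidean_space"
  assumes "open U" "u \<in> U"
    and \<sigma>: "semismooth_at \<sigma> U \<Psi> u"
    and \<phi>: "semismooth_at \<phi> D \<Phi> (u, \<sigma> u)"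
    and D: "\<And>x. x \<in> U \<Longrightarrow> (x, \<sigma> x) \<in> D"
    and \<Theta>: "\<And>x. x \<in> U \<Longrightarrow> \<Theta> x = (\<lambda>(C, A). C o\<^sub>L graph_op A) ` (\<Phi> (x, \<sigma> x) \<times> \<Psi> x)"
  shows "semismooth_at (\<lambda>x. \<phi> (x, \<sigma> x)) U \<Theta> u"
proof -
  obtain r1 B1 where "r1 > 0" "B1 > 0"
    and B1: "\<And>x A. \<lbrakk>dist x u < r1; A \<in> \<Psi> x\<rbrakk> \<Longrightarrow> norm A \<le> B1"
    and ne1: "\<And>x. dist x u < r1 \<Longrightarrow> \<Psi> x \<noteq> {}"
    and small1: "\<And>\<epsilon>. \<epsilon> > 0 \<Longrightarrow> \<exists>\<delta>>0. \<forall>x \<in> U. norm (x - u) < \<delta> \<longrightarrow>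
      (\<forall>A \<in> \<Psi> x. norm (\<sigma> x - \<sigma> u - blinfun_apply A (x - u)) \<le> \<epsilon> * norm (x - u))"
    by (rule semismooth_atE[OF \<sigma>]) blast
  obtain r2 B2 where "r2 > 0" "B2 > 0"
    and B2: "\<And>w C. \<lbrakk>dist w (u, \<sigma> u) < r2; C \<in> \<Phi> w\<rbrakk> \<Longrightarrow> norm C \<le> B2"
    and ne2: "\<And>w. dist w (u, \<sigma> u) < r2 \<Longrightarrow> \<Phi> w \<noteq> {}"
    and small2: "\<And>\<epsilon>. \<epsilon> > 0 \<Longrightarrow> \<exists>\<delta>>0. \<forall>w \<in> D. norm (w - (u, \<sigma> u)) < \<delta> \<longrightarrow>
      (\<forall>C \<in> \<Phi> w. norm (\<phi> w - \<phi> (u, \<sigma> u) - blinfun_apply C (w - (u, \<sigma> u)))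
        \<le> \<epsilon> * norm (w - (u, \<sigma> u)))"
    by (rule semismooth_atE[OF \<phi>]) blast
  obtain r3 K where "r3 > 0" "K > 0"
    and K: "\<And>x. \<lbrakk>x \<in> U; norm (x - u) < r3\<rbrakk> \<Longrightarrow> norm (\<sigma> x - \<sigma> u) \<le> K * norm (x - u)"
    using semismooth_at_imp_calm[OF \<sigma>] by blast
  obtain r4 where "r4 > 0" and r4: "\<And>x. dist x u < r4 \<Longrightarrow> x \<in> U"
    using assms(1,2) unfolding open_dist by blast
  have graph_calm: "norm ((x, \<sigma> x) - (u, \<sigma> u)) \<le> (1 + K) * norm (x - u)"
    if "x \<in> U" "norm (x - u) < r3" for x
    using norm_Pair_le[of "x - u" "\<sigma> x - \<sigma> u"] K[OF that] by (simp add: distrib_right)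
  \<comment> \<open>The entry \<open>r2 / (1 + K)\<close> keeps the graph point within
    \<open>r2\<close> of \<open>(u, \<sigma> u)\<close>, by calmness.\<close>
  define r where "r = min (min r1 r4) (min r3 (r2 / (1 + K)))"
  have "r > 0"
    using \<open>r1 > 0\<close> \<open>r2 > 0\<close> \<open>r3 > 0\<close> \<open>r4 > 0\<close> \<open>K > 0\<close> by (simp add: r_def)
  have near: "x \<in> U" "dist x u < r1" "dist (x, \<sigma> x) (u, \<sigma> u) < r2" if "dist x u < r" for x
  proof -
    show x: "x \<in> U" "dist x u < r1"
      using that r4 by (simp_all add: r_def)
    have "(1 + K) * norm (x - u) < r2"
      using that \<open>K > 0\<close> by (simp add: r_def dist_norm pos_less_divide_eq mult.commute)
    then show "dist (x, \<sigma> x) (u, \<sigma> u) < r2"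
      using graph_calm[OF x(1)] that by (simp add: r_def dist_norm)
  qed
  show ?thesis
  proof (rule semismooth_atI)
    have "ball u r \<subseteq> {x. \<Theta> x \<noteq> {}}"
      using near ne1 ne2 \<Theta> by (auto simp: dist_commute)
    then show "u \<in> interior {x. \<Theta> x \<noteq> {}}"
      unfolding mem_interior using \<open>r > 0\<close> by blast
    show "norm T \<le> B2 * (1 + B1)" if x: "x \<in> ball u r" and "T \<in> \<Theta> x" for x T
    proof -
      have "dist x u < r"
        using x by (simp add: dist_commute)
      note near = near[OF this]
      obtain C A where T: "T = C o\<^sub>L graph_op A" and "C \<in> \<Phi> (x, \<sigma> x)" "A \<in> \<Psi> x"
        using \<open>T \<in> \<Theta> x\<close> \<Theta>[OF near(1)] by auto
      then have "norm C \<le> B2" "norm A \<le> B1"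
        using near B1 B2 by auto
      moreover have "norm T \<le> norm C * norm (graph_op A)"
        unfolding T by (rule norm_blinfun_compose)
      ultimately show ?thesis
        using norm_graph_op_le[of A] \<open>B2 > 0\<close> by (smt (verit) mult_mono norm_ge_zero)
    qed
  next
    fix \<epsilon> :: real assume "\<epsilon> > 0"
    \<comment> \<open>Each part receives half of \<epsilon>: \<open>\<epsilon>1\<close> offsets the
      bound \<open>B2\<close> on \<open>C\<close>, and \<open>\<epsilon>2\<close> offsets the
      calmness factor \<open>1 + K\<close>.\<close>
    define \<epsilon>1 where "\<epsilon>1 = \<epsilon> / (2 * B2)"
    define \<epsilon>2 where "\<epsilon>2 = \<epsilon> / (2 * (1 + K))"
    have "\<epsilon>1 > 0" "\<epsilon>2 > 0"
      using \<open>\<epsilon> > 0\<close> \<open>B2 > 0\<close> \<open>K > 0\<close> by (simp_all add: \<epsilon>1_def \<epsilon>2_def)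
    obtain \<delta>1 where "\<delta>1 > 0" and \<delta>1: "\<And>x A. \<lbrakk>x \<in> U; norm (x - u) < \<delta>1; A \<in> \<Psi> x\<rbrakk> \<Longrightarrow>
        norm (\<sigma> x - \<sigma> u - blinfun_apply A (x - u)) \<le> \<epsilon>1 * norm (x - u)"
      using small1[OF \<open>\<epsilon>1 > 0\<close>] by blast
    obtain \<delta>2 where "\<delta>2 > 0" and \<delta>2: "\<And>w C. \<lbrakk>w \<in> D; norm (w - (u, \<sigma> u)) < \<delta>2; C \<in> \<Phi> w\<rbrakk> \<Longrightarrow>
        norm (\<phi> w - \<phi> (u, \<sigma> u) - blinfun_apply C (w - (u, \<sigma> u))) \<le> \<epsilon>2 * norm (w - (u, \<sigma> u))"
      using small2[OF \<open>\<epsilon>2 > 0\<close>] by blast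
    define \<delta> where "\<delta> = min (min r \<delta>1) (\<delta>2 / (1 + K))"
    have "\<delta> > 0"
      using \<open>r > 0\<close> \<open>\<delta>1 > 0\<close> \<open>\<delta>2 > 0\<close> \<open>K > 0\<close> by (simp add: \<delta>_def)
    have "norm (\<phi> (x, \<sigma> x) - \<phi> (u, \<sigma> u) - blinfun_apply T (x - u)) \<le> \<epsilon> * norm (x - u)"
      if x: "x \<in> U" "norm (x - u) < \<delta>" and T: "T \<in> \<Theta> x" for x T
    proof -
      have "norm (x - u) < r3" "dist x u < r"
        using x by (simp_all add: \<delta>_def r_def dist_norm)
      note near = near[OF this(2)] and calm = graph_calm[OF x(1) this(1)]
      obtain C A where CA: "T = C o\<^sub>L graph_op A" "C \<in> \<Phi> (x, \<sigma> x)" "A \<in> \<Psi> x"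
        using T \<Theta>[OF x(1)] by auto
      have "norm C \<le> B2"
        using B2 near CA by blast
      let ?w = "(x, \<sigma> x) - (u, \<sigma> u)" and ?e = "\<sigma> x - \<sigma> u - blinfun_apply A (x - u)"
      have "(1 + K) * norm (x - u) < \<delta>2"
        using x(2) \<open>K > 0\<close> by (simp add: \<delta>_def pos_less_divide_eq mult.commute)
      then have "norm (\<phi> (x, \<sigma> x) - \<phi> (u, \<sigma> u) - blinfun_apply C ?w) \<le> \<epsilon>2 * norm ?w"
        using calm CA(2) by (intro \<delta>2 D x(1)) auto
      also have "\<dots> \<le> \<epsilon>2 * ((1 + K) * norm (x - u))"
        using calm \<open>\<epsilon>2 > 0\<close> by (intro mult_left_mono) auto
      also have "\<dots> = \<epsilon>2 * (1 + K) * norm (x - u)"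
        by (simp only: mult.assoc)
      also have "\<epsilon>2 * (1 + K) = \<epsilon> / 2"
        using \<open>K > 0\<close> by (simp add: \<epsilon>2_def field_simps)
      finally have 1: "norm (\<phi> (x, \<sigma> x) - \<phi> (u, \<sigma> u) - blinfun_apply C ?w) \<le> \<epsilon> / 2 * norm (x - u)" .
      have "norm (blinfun_apply C (0, ?e)) \<le> norm C * norm ?e"
        using norm_blinfun[of C "(0, ?e)"] by (simp add: norm_Pair)
      also have "\<dots> \<le> B2 * (\<epsilon>1 * norm (x - u))"
        using \<open>norm C \<le> B2\<close> \<open>B2 > 0\<close> \<delta>1[OF x(1) _ CA(3)] x(2)
        by (intro mult_mono) (auto simp: \<delta>_def)
      also have "\<dots> = \<epsilon> / 2 * norm (x - u)"
        using \<open>B2 > 0\<close> by (simp add: \<epsilon>1_def)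
      finally have 2: "norm (blinfun_apply C (0, ?e)) \<le> \<epsilon> / 2 * norm (x - u)" .
      \<comment> \<open>The graph displacement is its linear prediction \<open>graph_op A\<close>
        plus the error of \<sigma> in the second component.\<close>
      have "blinfun_apply C ?w = blinfun_apply T (x - u) + blinfun_apply C (0, ?e)"
        by (simp add: CA(1) flip: blinfun.add_right)
      then have "\<phi> (x, \<sigma> x) - \<phi> (u, \<sigma> u) - blinfun_apply T (x - u) =
          (\<phi> (x, \<sigma> x) - \<phi> (u, \<sigma> u) - blinfun_apply C ?w) + blinfun_apply C (0, ?e)"
        by simp
      also have "norm \<dots> \<le> \<epsilon> * norm (x - u)"
        using 1 2 by (intro norm_triangle_le) simp
      finally show ?thesis .
    qed
    then show "\<exists>\<delta>>0. \<forall>x \<in> U. norm (x - u) < \<delta> \<longrightarrow> (\<forall>T \<in> \<Theta> x.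
        norm (\<phi> (x, \<sigma> x) - \<phi> (u, \<sigma> u) - blinfun_apply T (x - u)) \<le> \<epsilon> * norm (x - u))"
      using \<open>\<delta> > 0\<close> by blast
  qed (rule \<open>r > 0\<close>)
qed

section \<open>Semismoothness of the implicit mapping\<close>

text \<open>The image of \<open>p\<close> under \<open>X_mat L\<close> is part of a vector of
  \<open>L\<close> with last component \<open>p\<close>, so \<kappa> bounds the matrix. The bound
  transfers to the transpose by testing its image against itself.\<close>

lemma scd_adj_norm_matrix_le:
  fixes F :: "(real^'n) \<times> (real^'m) \<Rightarrow> (real^'m) set"
  assumes "scd_reg F w < \<infinity>" "L \<in> scd_adj F w" "\<kappa> > 0"
    and \<kappa>: "\<And>z x y. (z, (x, y)) \<in> L \<Longrightarrow> norm (z, x) \<le> \<kappa> * norm y"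
  shows "norm (matrix_op (- transpose (X_mat L))) \<le> \<kappa>"
proof (rule norm_blinfun_bound)
  let ?X = "X_mat L"
  obtain Z where L: "L = {(Z *v p, ?X *v p, p) |p. True}"
    using scd_adj_representation[OF assms(1,2)] by blast
  have X: "norm (?X *v p) \<le> \<kappa> * norm p" for p
    using \<kappa>[of "Z *v p" "?X *v p" p] L norm_snd_le[of "?X *v p" "Z *v p"] by force
  show "norm (blinfun_apply (matrix_op (- transpose ?X)) v) \<le> \<kappa> * norm v" for v
  proof -
    let ?a = "transpose ?X *v v"
    have "?a \<bullet> ?a = v \<bullet> (?X *v ?a)"
      by (rule inner_transpose_matrix)
    also have "\<dots> \<le> norm v * norm (?X *v ?a)"
      by (rule norm_cauchy_schwarz)
    also have "\<dots> \<le> norm v * (\<kappa> * norm ?a)"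
      by (intro mult_left_mono X) simp
    finally have "norm ?a \<le> \<kappa> * norm v"
      using \<open>\<kappa> > 0\<close> by (intro norm_le_if_inner_le) (simp_all add: algebra_simps)
    then show ?thesis
      by (simp add: minus_matrix_vector_mult del: transpose_matrix_vector)
  qed
qed (use \<open>\<kappa> > 0\<close> in simp)

text \<open>The assumption \<open>ss\<close> is the semismooth* inequality between two points with
  the same last component, where the term in \<open>zs\<close> vanishes. The linearization error is
  then used as its own test vector.\<close>

lemma scd_adj_error_le:
  fixes F :: "(real^'n) \<times> (real^'m) \<Rightarrow> (real^'m) set"
  assumes "scd_reg F ((x, y), 0) < \<infinity>" "L \<in> scd_adj F ((x, y), 0)" "\<kappa> > 0" "\<epsilon> > 0"
    and \<kappa>: "\<And>z x y. (z, (x, y)) \<in> L \<Longrightarrow> norm (z, x) \<le> \<kappa> * norm y"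
    and ss: "\<And>zs xs. (zs, xs) \<in> L \<Longrightarrow> \<bar>xs \<bullet> ((x, y) - (x0, y0))\<bar>
      \<le> \<epsilon> * norm ((x, y) - (x0, y0)) * norm (zs, xs)"
  shows "norm (y - y0 - blinfun_apply (matrix_op (- transpose (X_mat L))) (x - x0))
    \<le> \<epsilon> * (1 + \<kappa>) * norm ((x, y) - (x0, y0))"
proof -
  let ?X = "X_mat L" and ?N = "norm ((x, y) - (x0, y0))"
  obtain Z where L: "L = {(Z *v p, ?X *v p, p) |p. True}"
    using scd_adj_representation[OF assms(1,2)] by blast
  \<comment> \<open>This is the error to be estimated. As parameter of \<open>L\<close> it selects
    the adjoint vector whose pairing with the displacement is the squared norm of
    \<open>p\<close>.\<close>
  define p where "p = y - y0 + transpose ?X *v (x - x0)"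
  have mem: "(Z *v p, (?X *v p, p)) \<in> L"
    using L by blast
  have "norm (Z *v p, (?X *v p, p)) = norm ((Z *v p, ?X *v p), p)"
    by (simp add: norm_Pair add.assoc)
  also have "\<dots> \<le> (1 + \<kappa>) * norm p"
    using norm_Pair_le[of "(Z *v p, ?X *v p)" p] \<kappa>[OF mem] by (simp add: distrib_right)
  finally have norm_le: "norm (Z *v p, (?X *v p, p)) \<le> (1 + \<kappa>) * norm p" .
  have "p \<bullet> p = (?X *v p, p) \<bullet> ((x, y) - (x0, y0))"
    using inner_transpose_matrix[of ?X "x - x0" p]
    by (subst (2) p_def) (simp add: inner_add_right inner_commute del: transpose_matrix_vector)
  also have "\<dots> \<le> \<epsilon> * ?N * norm (Z *v p, (?X *v p, p))"
    using ss[OF mem] by linarith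
  also have "\<dots> \<le> \<epsilon> * ?N * ((1 + \<kappa>) * norm p)"
    using \<open>\<epsilon> > 0\<close> by (intro mult_left_mono norm_le) simp
  finally have "norm p \<le> \<epsilon> * (1 + \<kappa>) * ?N"
    using \<open>\<epsilon> > 0\<close> \<open>\<kappa> > 0\<close> by (intro norm_le_if_inner_le) (simp_all add: algebra_simps)
  then show ?thesis
    by (simp add: p_def minus_matrix_vector_mult
        del: transpose_matrix_vector)
qed

lemma scd_semismooth_starE:
  fixes G :: "'a::euclidean_space \<Rightarrow> 'b::euclidean_space set"
  assumes "scd_semismooth_star G w0" "\<epsilon> > 0"
  obtains \<delta> where "\<delta> > 0"
    "\<And>w ys xs. \<lbrakk>w \<in> gph G; norm (w - w0) \<le> \<delta>; (ys, xs) \<in> \<Union>(scd_adj G w)\<rbrakk> \<Longrightarrow>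
      \<bar>xs \<bullet> (fst w - fst w0) - ys \<bullet> (snd w - snd w0)\<bar> \<le> \<epsilon> * norm (w - w0) * norm (ys, xs)"
proof -
  obtain \<delta> where "\<delta> > 0" and \<delta>: "\<forall>w \<in> gph G. norm (w - w0) \<le> \<delta> \<longrightarrow>
        (\<forall>(ys, xs) \<in> \<Union>(scd_adj G w).
           \<bar>xs \<bullet> (fst w - fst w0) - ys \<bullet> (snd w - snd w0)\<bar> \<le> \<epsilon> * norm (w - w0) * norm (ys, xs))"
    using assms unfolding scd_semismooth_star_def by meson
  show thesis
  proof (rule that[OF \<open>\<delta> > 0\<close>])
    fix w ys xs assume "w \<in> gph G" "norm (w - w0) \<le> \<delta>" and mem: "(ys, xs) \<in> \<Union>(scd_adj G w)"
    with \<delta> have "\<forall>(ys, xs) \<in> \<Union>(scd_adj G w).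
        \<bar>xs \<bullet> (fst w - fst w0) - ys \<bullet> (snd w - snd w0)\<bar> \<le> \<epsilon> * norm (w - w0) * norm (ys, xs)"
      by blast
    from bspec[OF this mem]
    show "\<bar>xs \<bullet> (fst w - fst w0) - ys \<bullet> (snd w - snd w0)\<bar> \<le> \<epsilon> * norm (w - w0) * norm (ys, xs)"
      by (rule case_prodD)
  qed
qed

text \<open>Continuity of \<sigma> brings nearby graph points into the region where the constant
  \<kappa> found at \<open>u\<close> and the semismooth* inequality at \<open>u\<close> hold. The
  resulting error is measured by the graph displacement and must be converted to the displacement of
  \<open>x\<close>.\<close>

lemma semismooth_at_implicit:
  fixes F :: "(real^'n) \<times> (real^'m) \<Rightarrow> (real^'m) set"
    and \<sigma> :: "real^'n \<Rightarrow> real^'m"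
  assumes "open \<Omega>" "continuous_on \<Omega> \<sigma>"
    and gph: "\<And>x. x \<in> \<Omega> \<Longrightarrow> 0 \<in> F (x, \<sigma> x)"
    and ss: "\<And>x. x \<in> \<Omega> \<Longrightarrow> scd_semismooth_star F ((x, \<sigma> x), 0)"
    and reg: "\<And>x. x \<in> \<Omega> \<Longrightarrow> scd_reg F ((x, \<sigma> x), 0) < \<infinity>"
    and "u \<in> \<Omega>"
  shows "semismooth_at \<sigma> \<Omega> (\<lambda>x. matrix_op ` Psi_map F \<Omega> \<sigma> x) u"
proof -
  let ?w = "\<lambda>x. ((x, \<sigma> x), 0 :: real^'m)"
  let ?\<Psi> = "\<lambda>x. matrix_op ` Psi_map F \<Omega> \<sigma> x"
  have w_gph: "?w x \<in> gph F" if "x \<in> \<Omega>" for x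
    using gph that unfolding gph_def by simp
  have \<Psi>_eq: "?\<Psi> x = (\<lambda>L. matrix_op (- transpose (X_mat L))) ` scd_adj F (?w x)" if "x \<in> \<Omega>" for x
    using that unfolding Psi_map_def by auto
  \<comment> \<open>The nonemptiness clause of semismoothness* at \<open>?w x\<close> is applied at
    that point itself.\<close>
  have ne: "?\<Psi> x \<noteq> {}" if "x \<in> \<Omega>" for x
    using ss[OF that] w_gph[OF that] unfolding \<Psi>_eq[OF that] scd_semismooth_star_def by auto
  obtain \<rho> \<kappa> where "\<rho> > 0" "\<kappa> > 0"
    and \<kappa>: "\<And>v z x y. \<lbrakk>dist v (?w u) < \<rho>; (z, (x, y)) \<in> \<Union>(scd_adj F v)\<rbrakk> \<Longrightarrow>
      norm (z, x) \<le> \<kappa> * norm y"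
    using scd_reg_locally_bounded[OF reg[OF \<open>u \<in> \<Omega>\<close>]] by blast
  have "continuous_on \<Omega> ?w"
    by (intro continuous_intros assms(2))
  then have near: "\<exists>\<delta>>0. \<forall>x. dist x u < \<delta> \<longrightarrow> x \<in> \<Omega> \<and> dist (?w x) (?w u) < \<epsilon>" if "\<epsilon> > 0" for \<epsilon>
  proof -
    obtain \<delta>1 where "\<delta>1 > 0" "\<And>x. \<lbrakk>x \<in> \<Omega>; dist x u < \<delta>1\<rbrakk> \<Longrightarrow> dist (?w x) (?w u) < \<epsilon>"
      using \<open>continuous_on \<Omega> ?w\<close> \<open>u \<in> \<Omega>\<close> \<open>\<epsilon> > 0\<close> unfolding continuous_on_iff by meson
    moreover obtain \<delta>2 where "\<delta>2 > 0" "\<And>x. dist x u < \<delta>2 \<Longrightarrow> x \<in> \<Omega>"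
      using \<open>open \<Omega>\<close> \<open>u \<in> \<Omega>\<close> unfolding open_dist by blast
    ultimately show ?thesis
      by (intro exI[of _ "min \<delta>1 \<delta>2"]) auto
  qed
  obtain r where "r > 0" and r: "\<And>x. dist x u < r \<Longrightarrow> x \<in> \<Omega>"
      "\<And>x. dist x u < r \<Longrightarrow> dist (?w x) (?w u) < \<rho>"
    using near[OF \<open>\<rho> > 0\<close>] by blast
  have norm_le: "norm A \<le> \<kappa>" if x: "dist x u < r" and "A \<in> ?\<Psi> x" for x A
  proof -
    obtain L where L: "L \<in> scd_adj F (?w x)" and A: "A = matrix_op (- transpose (X_mat L))"
      using \<Psi>_eq[OF r(1)[OF x]] \<open>A \<in> ?\<Psi> x\<close> by auto
    show ?thesis
      unfolding A using L \<kappa>[OF r(2)[OF x]]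
      by (intro scd_adj_norm_matrix_le[OF reg[OF r(1)[OF x]] L \<open>\<kappa> > 0\<close>]) blast
  qed
  show ?thesis
  proof (rule semismooth_atI[OF _ \<open>r > 0\<close>])
    have "ball u r \<subseteq> {x. ?\<Psi> x \<noteq> {}}"
      using ne r(1) by (auto simp: dist_commute)
    then show "u \<in> interior {x. ?\<Psi> x \<noteq> {}}"
      unfolding mem_interior using \<open>r > 0\<close> by blast
    show "norm A \<le> \<kappa>" if "x \<in> ball u r" "A \<in> ?\<Psi> x" for x A
      using norm_le that by (simp add: dist_commute)
  next
    fix \<epsilon> :: real assume "\<epsilon> > 0"
    \<comment> \<open>The bound 1/2 permits absorbing half of the graph displacement, and the other
      bound makes the final constant at most \<epsilon>. The choice of \<open>\<epsilon>'\<close>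
      then cancels the factor \<open>1 + \<kappa>\<close> of the error estimate.\<close>
    define \<eta> where "\<eta> = min (1 / 2) (\<epsilon> / (2 * (1 + \<kappa>)))"
    define \<epsilon>' where "\<epsilon>' = \<eta> / (1 + \<kappa>)"
    have "\<eta> > 0"
      using \<open>\<epsilon> > 0\<close> \<open>\<kappa> > 0\<close> by (simp add: \<eta>_def)
    moreover have "\<eta> \<le> 1 / 2"
      unfolding \<eta>_def by (rule min.cobounded1)
    ultimately have \<eta>: "\<eta> > 0" "\<eta> \<le> 1 / 2"
      by blast+
    have "\<eta> \<le> \<epsilon> / (2 * (1 + \<kappa>))"
      by (simp add: \<eta>_def)
    then have \<eta>_le: "\<eta> * (2 * (1 + \<kappa>)) \<le> \<epsilon>"
      using \<open>\<kappa> > 0\<close> by (subst (asm) pos_le_divide_eq) simp_all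
    have \<epsilon>': "\<epsilon>' > 0" "\<epsilon>' * (1 + \<kappa>) = \<eta>"
      using \<eta>(1) \<open>\<kappa> > 0\<close> by (simp_all add: \<epsilon>'_def)
    obtain \<delta>1 where "\<delta>1 > 0" and \<delta>1: "\<And>v zs xs. \<lbrakk>v \<in> gph F; norm (v - ?w u) \<le> \<delta>1;
        (zs, xs) \<in> \<Union>(scd_adj F v)\<rbrakk> \<Longrightarrow>
        \<bar>xs \<bullet> (fst v - fst (?w u)) - zs \<bullet> (snd v - snd (?w u))\<bar> \<le> \<epsilon>' * norm (v - ?w u) * norm (zs, xs)"
      using scd_semismooth_starE[OF ss[OF \<open>u \<in> \<Omega>\<close>] \<epsilon>'(1)] by blast
    obtain \<delta>2 where "\<delta>2 > 0" and \<delta>2: "\<And>x. dist x u < \<delta>2 \<Longrightarrow> dist (?w x) (?w u) < \<delta>1"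
      using near[OF \<open>\<delta>1 > 0\<close>] by blast
    have "norm (\<sigma> x - \<sigma> u - blinfun_apply A (x - u)) \<le> \<epsilon> * norm (x - u)"
      if "x \<in> \<Omega>" and x: "norm (x - u) < min r \<delta>2" and A: "A \<in> ?\<Psi> x" for x A
    proof -
      have dist: "dist x u < r" "dist x u < \<delta>2"
        using x by (simp_all add: dist_norm)
      obtain L where L: "L \<in> scd_adj F (?w x)" and A_eq: "A = matrix_op (- transpose (X_mat L))"
        using \<Psi>_eq[OF \<open>x \<in> \<Omega>\<close>] A by auto
      let ?N = "norm ((x, \<sigma> x) - (u, \<sigma> u))"
      let ?e = "\<sigma> x - \<sigma> u - blinfun_apply A (x - u)"
      have "norm ?e \<le> \<epsilon>' * (1 + \<kappa>) * ?N"
        unfolding A_eq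
      proof (rule scd_adj_error_le[OF reg[OF \<open>x \<in> \<Omega>\<close>] L \<open>\<kappa> > 0\<close> \<epsilon>'(1)])
        show "norm (z, a) \<le> \<kappa> * norm b" if "(z, (a, b)) \<in> L" for z a b
          using \<kappa>[OF r(2)[OF dist(1)]] that L by blast
        \<comment> \<open>Both points have last component 0, so only the displacement in the first
          two variables remains.\<close>
        have "norm (?w x - ?w u) = ?N"
          by (simp add: norm_Pair)
        then show "\<bar>xs \<bullet> ((x, \<sigma> x) - (u, \<sigma> u))\<bar> \<le> \<epsilon>' * ?N * norm (zs, xs)" if "(zs, xs) \<in> L" for zs xs
          using \<delta>1[OF w_gph[OF \<open>x \<in> \<Omega>\<close>], of zs xs] \<delta>2[OF dist(2)] that L
          by (auto simp: dist_norm)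
      qed
      then have e: "norm ?e \<le> \<eta> * ?N"
        by (simp add: \<epsilon>'(2))
      have N: "?N \<le> norm (x - u) + norm (\<sigma> x - \<sigma> u)"
        using norm_Pair_le[of "x - u" "\<sigma> x - \<sigma> u"] by simp
      have "norm (blinfun_apply A (x - u)) \<le> \<kappa> * norm (x - u)"
        using norm_blinfun[of A "x - u"] norm_le[OF dist(1) A]
        by (meson mult_right_mono norm_ge_zero order_trans)
      moreover have "norm ?e \<le> 1 / 2 * ?N"
        using e \<eta>(2) by (meson mult_right_mono norm_ge_zero order_trans)
      ultimately have "norm (\<sigma> x - \<sigma> u) \<le> 1 / 2 * ?N + \<kappa> * norm (x - u)"
        using norm_triangle_sub[of "\<sigma> x - \<sigma> u" "blinfun_apply A (x - u)"] by linarith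
      \<comment> \<open>The term \<open>1 / 2 * ?N\<close> moves to the left; this amounts to
        calmness of \<sigma> at \<open>u\<close>.\<close>
      then have "?N \<le> 2 * (1 + \<kappa>) * norm (x - u)"
        using N by (simp add: algebra_simps)
      then have "\<eta> * ?N \<le> \<eta> * (2 * (1 + \<kappa>)) * norm (x - u)"
        using \<eta>(1) by (simp add: mult.assoc)
      also have "\<dots> \<le> \<epsilon> * norm (x - u)"
        using \<eta>_le by (intro mult_right_mono) simp_all
      finally show ?thesis
        using e by linarith
    qed
    then show "\<exists>\<delta>>0. \<forall>x \<in> \<Omega>. norm (x - u) < \<delta> \<longrightarrow> (\<forall>A \<in> ?\<Psi> x.
        norm (\<sigma> x - \<sigma> u - blinfun_apply A (x - u)) \<le> \<epsilon> * norm (x - u))"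
      using \<open>r > 0\<close> \<open>\<delta>2 > 0\<close> by (intro exI[of _ "min r \<delta>2"]) auto
  qed
qed

section \<open>The generalized derivative of the composed function\<close>

text \<open>The row given by \<open>gx\<close>, \<open>gy\<close> and \<open>L\<close> is the pair
  of rows composed with the block operator of identity and negative transpose of
  \<open>X_mat L\<close>, which is the form that the chain rule requires.\<close>

lemma row_op_Theta_map:
  assumes "x \<in> \<Omega>"
  shows "row_op ` Theta_map F \<Omega> \<sigma> \<Phi> x =
    (\<lambda>(C, A). C o\<^sub>L graph_op A) ` (row_op ` \<Phi> (x, \<sigma> x) \<times> matrix_op ` Psi_map F \<Omega> \<sigma> x)"
proof -
  have eq: "row_op (gx - gy v* transpose (X_mat L)) =
      row_op (gx, gy) o\<^sub>L graph_op (matrix_op (- transpose (X_mat L)))" for gx gy L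
    by (rule blinfun_eqI) (simp add: minus_matrix_vector_mult
        inner_diff_left dot_lmul_matrix del: transpose_matrix_vector vector_transpose_matrix)
  show ?thesis
  proof (intro equalityI subsetI)
    fix T assume "T \<in> row_op ` Theta_map F \<Omega> \<sigma> \<Phi> x"
    then obtain gx gy L where "(gx, gy) \<in> \<Phi> (x, \<sigma> x)" "L \<in> scd_adj F ((x, \<sigma> x), 0)"
      "T = row_op (gx - gy v* transpose (X_mat L))"
      using assms unfolding Theta_map_def by auto
    then show "T \<in> (\<lambda>(C, A). C o\<^sub>L graph_op A) `
        (row_op ` \<Phi> (x, \<sigma> x) \<times> matrix_op ` Psi_map F \<Omega> \<sigma> x)"
      using assms unfolding eq Psi_map_def by force
  next
    fix T assume "T \<in> (\<lambda>(C, A). C o\<^sub>L graph_op A) `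
        (row_op ` \<Phi> (x, \<sigma> x) \<times> matrix_op ` Psi_map F \<Omega> \<sigma> x)"
    then obtain gx gy L where "(gx, gy) \<in> \<Phi> (x, \<sigma> x)" "L \<in> scd_adj F ((x, \<sigma> x), 0)"
      "T = row_op (gx, gy) o\<^sub>L graph_op (matrix_op (- transpose (X_mat L)))"
      using assms unfolding Psi_map_def by auto
    then show "T \<in> row_op ` Theta_map F \<Omega> \<sigma> \<Phi> x"
      using assms unfolding eq[symmetric] Theta_map_def by auto
  qed
qed

theorem corollary5p10:
  fixes F :: "(real^'n) \<times> (real^'m) \<Rightarrow> (real^'m) set"
    and \<sigma> :: "real^'n \<Rightarrow> real^'m"
    and \<Omega> :: "(real^'n) set"
  assumes "open \<Omega>"
    and "continuous_on \<Omega> \<sigma>"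
    and "\<And>x. x \<in> \<Omega> \<Longrightarrow> 0 \<in> F (x, \<sigma> x)"
    and "\<And>x. x \<in> \<Omega> \<Longrightarrow> scd_semismooth_star F ((x, \<sigma> x), 0)"
    and "\<And>x. x \<in> \<Omega> \<Longrightarrow> scd_reg F ((x, \<sigma> x), 0) < \<infinity>"
  shows "semismooth_on \<Omega> \<sigma> \<Omega> (\<lambda>x. matrix_op ` Psi_map F \<Omega> \<sigma> x) \<and>
    (\<forall>(D :: ((real^'n) \<times> (real^'m)) set) (\<phi> :: (real^'n) \<times> (real^'m) \<Rightarrow> real)
       (\<Phi> :: (real^'n) \<times> (real^'m) \<Rightarrow> ((real^'n) \<times> (real^'m)) set).
       open D \<and> (\<lambda>x. (x, \<sigma> x)) ` \<Omega> \<subseteq> D \<and>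
       semismooth_on ((\<lambda>x. (x, \<sigma> x)) ` \<Omega>) \<phi> D (\<lambda>w. row_op ` \<Phi> w) \<longrightarrow>
       semismooth_on \<Omega> (\<lambda>x. \<phi> (x, \<sigma> x)) \<Omega> (\<lambda>x. row_op ` Theta_map F \<Omega> \<sigma> \<Phi> x))"
proof -
  have \<sigma>: "semismooth_at \<sigma> \<Omega> (\<lambda>x. matrix_op ` Psi_map F \<Omega> \<sigma> x) u" if "u \<in> \<Omega>" for u
    by (rule semismooth_at_implicit[OF assms that])
  have "semismooth_at (\<lambda>x. \<phi> (x, \<sigma> x)) \<Omega> (\<lambda>x. row_op ` Theta_map F \<Omega> \<sigma> \<Phi> x) u"
    if "(\<lambda>x. (x, \<sigma> x)) ` \<Omega> \<subseteq> D" "u \<in> \<Omega>"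
      "semismooth_on ((\<lambda>x. (x, \<sigma> x)) ` \<Omega>) \<phi> D (\<lambda>w. row_op ` \<Phi> w)"
    for D u and \<phi> :: "(real^'n) \<times> (real^'m) \<Rightarrow> real" and \<Phi>
  proof (rule semismooth_at_compose_graph[OF assms(1) that(2) \<sigma>[OF that(2)]])
    show "semismooth_at \<phi> D (\<lambda>w. row_op ` \<Phi> w) (u, \<sigma> u)"
      using that unfolding semismooth_on_def by blast
    show "(x, \<sigma> x) \<in> D" if "x \<in> \<Omega>" for x
      using \<open>(\<lambda>x. (x, \<sigma> x)) ` \<Omega> \<subseteq> D\<close> that by blast
  qed (rule row_op_Theta_map)
  then show ?thesis
    using \<sigma> unfolding semismooth_on_def by blast
qed

end
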